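(* Let $\mathbb{K}$ be an algebraically closed field of characteristic different from $2$ and $3$. For any $\alpha_1,\alpha_2,\alpha_3\in\mathbb{K}$, the algebra $\mathcal{T}(\alpha_1,\alpha_2,\alpha_3)$ is a PBW deformation of $B$, and the elements $$(b-a)^{n_1}a^{n_2}c^{n_3}y^{n_4}d^{n_5},\qquad n_1,n_4\in\{0,1,2\},\quad n_2,n_3,n_5\in\{0,1\},$$ where $y=ac+cb+ba-\alpha_2$, form a basis of $\mathcal{T}(\alpha_1,\alpha_2,\alpha_3)$ as a $\mathbb{K}$-vector space.
   Context: $B$ denotes the associative unital $\mathbb{K}$-algebra given by generators $a,b,c,d$ and relations $$a^2=b^2=c^2=d^2=0,$$ $$ab+bc+ca=0,\quad ac+cd+da=0,\quad ad+ba+db=0,\quad bd+cb+dc=0,\quad (a+b+c)^6=0,$$ $\mathbb{N}_0$-graded with $a,b,c,d$ in degree $1$. $\mathcal{T}(\alpha_1,\alpha_2,\alpha_3)$ denotes the associative unital $\mathbb{K}$-algebra given by generators $a,b,c,d$ and relations $$a^2=b^2=c^2=d^2=\alpha_1,$$ $$ca+bc+ab=\alpha_2,\quad da+cd+ac=\alpha_2,\quad db+ba+ad=\alpha_2,\quad dc+cb+bd=\alpha_2,$$ $$(cb+ba+ac-\alpha_2)^3=\alpha_3.$$ A PBW deformation of an $\mathbb{N}_0$-graded algebra $A$ is an $\mathbb{N}_0$-filtered algebra $D$ such that the associated graded algebra $\mathrm{gr}\,D$ is isomorphic to $A$ (as a graded algebra). Here $\mathcal{T}(\alpha_1,\alpha_2,\alpha_3)$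 carries the filtration by degree in the generators: the $m$-th piece is spanned by the words of length at most $m$ in $a,b,c,d$. *)

theory Defs
  imports
    "HOL-Library.Poly_Mapping"
    "HOL-Algebra.QuotRing"
    "HOL-Algebra.Algebraic_Closure_Type"
    "Jordan_Normal_Form.Missing_VectorSpace"
begin

section \<open>Free algebras and presentations\<close>

datatype 'g word = Word (letters: "'g list")

instantiation word :: (type) monoid_add
begin

definition zero_word :: "'g word" where "zero_word = Word []"

definition plus_word :: "'g word \<Rightarrow> 'g word \<Rightarrow> 'g word" where
  "plus_word u v = Word (letters u @ letters v)"

instance
  by standard (simp_all add: zero_word_def plus_word_def)

end

text \<open>
  \<^typ>\<open>'g word\<close> is the free monoid, written additively so that \<^typ>\<open>'g word \<Rightarrow>\<^sub>0 'k\<close> with the convolution product of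
  \<^theory>\<open>HOL-Library.Poly_Mapping\<close> is the free associative unital algebra on \<^typ>\<open>'g\<close>.
\<close>

type_synonym ('g, 'k) free_algebra = "'g word \<Rightarrow>\<^sub>0 'k"

definition word_of :: "'g list \<Rightarrow> ('g, 'k::field) free_algebra" where
  "word_of w = Poly_Mapping.single (Word w) 1"

definition gen_of :: "'g \<Rightarrow> ('g, 'k::field) free_algebra" where
  "gen_of x = word_of [x]"

definition scal :: "'k::field \<Rightarrow> ('g, 'k) free_algebra" where
  "scal c = Poly_Mapping.single 0 c"

text \<open>
  Associative algebras over a field are encoded by \<^typ>\<open>('a, 'b) module\<close> records, whose \<open>mult\<close>
  and \<open>one\<close> fields carry the ring structure. (The locale \<^locale>\<open>algebra\<close> of the library is not
  applicable, as it requires commutativity.)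
\<close>

locale assoc_algebra = vectorspace K A for K and A (structure) +
  assumes ring: "ring A"
    and smult_mult_left:
      "\<lbrakk>c \<in> carrier K; x \<in> carrier A; y \<in> carrier A\<rbrakk> \<Longrightarrow> (c \<odot> x) \<otimes> y = c \<odot> (x \<otimes> y)"
    and smult_mult_right:
      "\<lbrakk>c \<in> carrier K; x \<in> carrier A; y \<in> carrier A\<rbrakk> \<Longrightarrow> x \<otimes> (c \<odot> y) = c \<odot> (x \<otimes> y)"

definition free_alg :: "('k::field, ('g, 'k) free_algebra) module" where
  "free_alg = \<lparr>carrier = UNIV, monoid.mult = (*), one = 1, zero = 0, add = (+),
               module.smult = (\<lambda>c p. scal c * p)\<rparr>"

definition quot_alg :: "('k, 'b, 'm) module_scheme \<Rightarrow> 'b set \<Rightarrow> ('k, 'b set) module" where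
  "quot_alg A I =
     \<lparr>carrier = carrier (A Quot I), monoid.mult = monoid.mult (A Quot I), one = one (A Quot I),
      zero = zero (A Quot I), add = add (A Quot I),
      module.smult = (\<lambda>c S. \<Union>x\<in>S. I +>\<^bsub>A\<^esub> (c \<odot>\<^bsub>A\<^esub> x))\<rparr>"

definition rel_ideal :: "('g, 'k::field) free_algebra set \<Rightarrow> ('g, 'k) free_algebra set" where
  "rel_ideal R = Idl\<^bsub>free_alg\<^esub> R"

text \<open>The algebra with generators \<^typ>\<open>'g\<close> and relations \<open>r = 0\<close> for \<open>r \<in> R\<close>.\<close>

definition presented_alg ::
  "('g, 'k::field) free_algebra set \<Rightarrow> ('k, ('g, 'k) free_algebra set) module" where
  "presented_alg R = quot_alg free_alg (rel_ideal R)"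

definition pres_class ::
  "('g, 'k::field) free_algebra set \<Rightarrow> ('g, 'k) free_algebra \<Rightarrow> ('g, 'k) free_algebra set" where
  "pres_class R p = rel_ideal R +>\<^bsub>free_alg\<^esub> p"

definition word_filtration ::
  "('g, 'k::field) free_algebra set \<Rightarrow> nat \<Rightarrow> ('g, 'k) free_algebra set set" where
  "word_filtration R m =
     module.span ring_of_type_algebra (presented_alg R) {pres_class R (word_of w) | w. length w \<le> m}"

definition word_grading ::
  "('g, 'k::field) free_algebra set \<Rightarrow> nat \<Rightarrow> ('g, 'k) free_algebra set set" where
  "word_grading R m =
     module.span ring_of_type_algebra (presented_alg R) {pres_class R (word_of w) | w. length w = m}"


section \<open>Graded and filtered algebras, PBW deformations\<close>

locale graded_algebra = assoc_algebra K A for K and A (structure) +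
  fixes G :: "nat \<Rightarrow> _"
  assumes piece_subspace: "subspace K (G n) A"
    and one_piece: "\<one> \<in> G 0"
    and mult_piece: "\<lbrakk>x \<in> G i; y \<in> G j\<rbrakk> \<Longrightarrow> x \<otimes> y \<in> G (i + j)"
    and direct_sum: "x \<in> carrier A \<Longrightarrow>
      \<exists>!f. (\<forall>n. f n \<in> G n) \<and> finite {n. f n \<noteq> \<zero>} \<and> x = (\<Oplus>n\<in>{n. f n \<noteq> \<zero>}. f n)"

locale filtered_algebra = assoc_algebra K D for K and D (structure) +
  fixes F :: "nat \<Rightarrow> _"
  assumes filt_subspace: "subspace K (F n) D"
    and filt_mono: "F n \<subseteq> F (Suc n)"
    and filt_exhaustive: "(\<Union>n. F n) = carrier D"
    and one_filt: "\<one> \<in> F 0"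
    and mult_filt: "\<lbrakk>x \<in> F i; y \<in> F j\<rbrakk> \<Longrightarrow> x \<otimes> y \<in> F (i + j)"

text \<open>The piece preceding \<open>F n\<close>, with the convention that the piece of index \<open>-1\<close> is zero.\<close>

definition filt_pred :: "('k, 'b, 'm) module_scheme \<Rightarrow> (nat \<Rightarrow> 'b set) \<Rightarrow> nat \<Rightarrow> 'b set" where
  "filt_pred D F n = (if n = 0 then {\<zero>\<^bsub>D\<^esub>} else F (n - 1))"

text \<open>
  The associated graded algebra: the direct sum of the quotients of \<open>F n\<close> by \<open>filt_pred D F n\<close>.
  Its elements are the finitely supported families of cosets. Like \<^const>\<open>rcoset_mult\<close>, product and
  scalar product are formed from all representatives at once; for a filtered algebra \<open>D\<close> the
  unions below are unions of copies of one and the same coset.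
\<close>

definition gr_alg ::
  "('k, 'b, 'm) module_scheme \<Rightarrow> (nat \<Rightarrow> 'b set) \<Rightarrow> ('k, nat \<Rightarrow> 'b set) module" where
  "gr_alg D F =
     \<lparr>carrier = {f. (\<forall>n. f n \<in> {filt_pred D F n +>\<^bsub>D\<^esub> x | x. x \<in> F n})
                    \<and> finite {n. f n \<noteq> filt_pred D F n}},
      monoid.mult = (\<lambda>f g n. \<Union>{filt_pred D F n +>\<^bsub>D\<^esub> (\<Oplus>\<^bsub>D\<^esub>i\<in>{..n}. u i \<otimes>\<^bsub>D\<^esub> v (n - i)) | u v.
                          (\<forall>i. u i \<in> f i) \<and> (\<forall>i. v i \<in> g i)}),
      one = (\<lambda>n. if n = 0 then filt_pred D F 0 +>\<^bsub>D\<^esub> \<one>\<^bsub>D\<^esub> else filt_pred D F n),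
      zero = filt_pred D F,
      add = (\<lambda>f g n. f n <+>\<^bsub>D\<^esub> g n),
      module.smult = (\<lambda>c f n. \<Union>x\<in>f n. filt_pred D F n +>\<^bsub>D\<^esub> (c \<odot>\<^bsub>D\<^esub> x))\<rparr>"

definition gr_piece ::
  "('k, 'b, 'm) module_scheme \<Rightarrow> (nat \<Rightarrow> 'b set) \<Rightarrow> nat \<Rightarrow> (nat \<Rightarrow> 'b set) set" where
  "gr_piece D F n = {f \<in> carrier (gr_alg D F). \<forall>m. m \<noteq> n \<longrightarrow> f m = filt_pred D F m}"

definition graded_isomorphic ::
  "('k, 'r) ring_scheme \<Rightarrow> ('k, 'a, 'm) module_scheme \<Rightarrow> (nat \<Rightarrow> 'a set)
     \<Rightarrow> ('k, 'b, 'n) module_scheme \<Rightarrow> (nat \<Rightarrow> 'b set) \<Rightarrow> bool" where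
  "graded_isomorphic K A G A' G' \<longleftrightarrow>
     (\<exists>\<phi>. \<phi> \<in> ring_iso A A' \<and> \<phi> \<in> module_hom K A A' \<and> (\<forall>n. \<phi> ` G n = G' n))"

definition pbw_deformation ::
  "('k, 'r) ring_scheme \<Rightarrow> ('k, 'a, 'm) module_scheme \<Rightarrow> (nat \<Rightarrow> 'a set)
     \<Rightarrow> ('k, 'b, 'n) module_scheme \<Rightarrow> (nat \<Rightarrow> 'b set) \<Rightarrow> bool" where
  "pbw_deformation K A G D F \<longleftrightarrow>
     graded_algebra K A G \<and> filtered_algebra K D F \<and>
     graded_isomorphic K (gr_alg D F) (gr_piece D F) A G"


section \<open>The algebras \<open>B\<close> and \<open>T(\<alpha>\<^sub>1, \<alpha>\<^sub>2, \<alpha>\<^sub>3)\<close>\<close>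

datatype gen = Ga | Gb | Gc | Gd

definition B_rels :: "(gen, 'k::field) free_algebra set" where
  "B_rels = (let a = gen_of Ga; b = gen_of Gb; c = gen_of Gc; d = gen_of Gd in
     {a^2, b^2, c^2, d^2,
      a*b + b*c + c*a, a*c + c*d + d*a, a*d + b*a + d*b, b*d + c*b + d*c,
      (a + b + c)^6})"

definition T_rels :: "'k::field \<Rightarrow> 'k \<Rightarrow> 'k \<Rightarrow> (gen, 'k) free_algebra set" where
  "T_rels \<alpha>1 \<alpha>2 \<alpha>3 = (let a = gen_of Ga; b = gen_of Gb; c = gen_of Gc; d = gen_of Gd in
     {a^2 - scal \<alpha>1, b^2 - scal \<alpha>1, c^2 - scal \<alpha>1, d^2 - scal \<alpha>1,
      c*a + b*c + a*b - scal \<alpha>2, d*a + c*d + a*c - scal \<alpha>2,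
      d*b + b*a + a*d - scal \<alpha>2, d*c + c*b + b*d - scal \<alpha>2,
      (c*b + b*a + a*c - scal \<alpha>2)^3 - scal \<alpha>3})"

abbreviation B_alg :: "('k::field, (gen, 'k) free_algebra set) module" where
  "B_alg \<equiv> presented_alg B_rels"

abbreviation T_alg :: "'k::field \<Rightarrow> 'k \<Rightarrow> 'k \<Rightarrow> ('k, (gen, 'k) free_algebra set) module" where
  "T_alg \<alpha>1 \<alpha>2 \<alpha>3 \<equiv> presented_alg (T_rels \<alpha>1 \<alpha>2 \<alpha>3)"

definition T_basis_elem ::
  "'k::field \<Rightarrow> 'k \<Rightarrow> 'k \<Rightarrow> nat \<times> nat \<times> nat \<times> nat \<times> nat \<Rightarrow> (gen, 'k) free_algebra set" where
  "T_basis_elem \<alpha>1 \<alpha>2 \<alpha>3 = (\<lambda>(n1, n2, n3, n4, n5).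
     let a = gen_of Ga; b = gen_of Gb; c = gen_of Gc; d = gen_of Gd; y = a*c + c*b + b*a - scal \<alpha>2
     in pres_class (T_rels \<alpha>1 \<alpha>2 \<alpha>3) ((b - a)^n1 * a^n2 * c^n3 * y^n4 * d^n5))"

definition T_basis_index :: "(nat \<times> nat \<times> nat \<times> nat \<times> nat) set" where
  "T_basis_index = {0,1,2} \<times> {0,1} \<times> {0,1} \<times> {0,1,2} \<times> {0,1}"

end

theory Submission
  imports Defs "HOL-Computational_Algebra.Polynomial"
begin

text \<open>
  The relations of \<open>B\<close> are homogeneous, and each of them is the leading form of a consequence of the
  relations of \<open>\<T>(\<alpha>\<^sub>1, \<alpha>\<^sub>2, \<alpha>\<^sub>3)\<close>; for \<open>(a + b + c)\<^sup>6\<close> this holds because \<open>(a + b + c)\<^sup>2 - y\<close> is a scalar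
  modulo the quadratic relations. Hence \<open>B\<close> maps onto the associated graded algebra. If the 72
  monomials span \<open>B\<close> and their deformed versions are linearly independent in \<open>\<T>\<close>, then comparing
  degree by degree shows that this map is injective and that the monomials form a basis of \<open>\<T>\<close>.

  Spanning: with \<open>e = b - a\<close> the relations give \<open>a e = - e\<^sup>2 - e a\<close>, \<open>e\<^sup>3 = 0\<close>, \<open>y a = c y\<close>, \<open>y b = a y\<close>,
  \<open>y c = b y\<close> and formulas for \<open>c a\<close> and \<open>c e\<close>, so the span of the monomials without \<open>d\<close> is stable under
  left multiplication by \<open>a\<close>, \<open>b\<close>, \<open>c\<close>; the relations containing \<open>d\<close> move \<open>d\<close> to the right.

  Independence: the same rewriting rules for general parameters yield \<open>12 \<times> 12\<close> matrices over a
  commutative ring with elements \<open>d\<close> and \<open>y\<close>, on which every relation acts as a multiple of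
  \<open>d\<^sup>2 - \<alpha>\<^sub>1\<close> or of \<open>y\<^sup>3 - \<alpha>\<^sub>3\<close>. The monomials take the first basis vector to the multiples of the
  basis vectors by \<open>y\<^sup>l d\<^sup>m\<close> with \<open>l < 3\<close> and \<open>m < 2\<close>, and these are independent modulo those two elements.
\<close>

section \<open>Free algebras and their quotients\<close>

lemma scal_add: "scal (c + c') = scal c + scal c'"
  by (simp add: scal_def single_add)

lemma scal_mult: "scal (c * c') = scal c * scal c'"
  by (simp add: scal_def mult_single)

lemma scal_0 [simp]: "scal 0 = 0"
  by (simp add: scal_def)

lemma scal_1 [simp]: "scal 1 = 1"
  by (simp add: scal_def)

lemma lookup_scal_mult: "Poly_Mapping.lookup (scal c * p) w = c * Poly_Mapping.lookup p w"
  by (simp add: scal_def mult_map_scale_conv_mult[symmetric] Poly_Mapping.map.rep_eq when_def)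

lemma poly_mapping_sum_single:
  "p = (\<Sum>w\<in>Poly_Mapping.keys p. Poly_Mapping.single w (Poly_Mapping.lookup p w))"
proof (rule poly_mapping_eqI)
  fix k
  have "(\<Sum>w\<in>Poly_Mapping.keys p. if w = k then Poly_Mapping.lookup p w else 0) = Poly_Mapping.lookup p k"
    by (subst sum.delta) (auto simp: in_keys_iff)
  then show "Poly_Mapping.lookup p k = Poly_Mapping.lookup (\<Sum>w\<in>Poly_Mapping.keys p. Poly_Mapping.single w (Poly_Mapping.lookup p w)) k"
    by (simp add: lookup_sum lookup_single when_def)
qed

lemma single_eq_scal_mult: "Poly_Mapping.single w c = scal c * word_of (letters w)"
  by (simp add: scal_def word_of_def mult_single)

lemma fa_expand: "p = (\<Sum>w\<in>Poly_Mapping.keys p. scal (Poly_Mapping.lookup p w) * word_of (letters w))"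
  using poly_mapping_sum_single[of p] by (simp add: single_eq_scal_mult)

text \<open>Scalars are multiples of the empty word, so they commute with every word, and by
  expansion in words with every element.\<close>

lemma scal_commute: "p * scal c = scal c * p"
proof -
  have "word_of u * scal c = scal c * word_of u" for u :: "'a list"
    by (simp add: word_of_def scal_def mult_single)
  then have "scal (Poly_Mapping.lookup p w) * word_of (letters w) * scal c =
      scal c * (scal (Poly_Mapping.lookup p w) * word_of (letters w))" for w
    by (simp only: mult.assoc) (simp only: mult.assoc[symmetric] scal_mult[symmetric] mult.commute)
  then show ?thesis
    by (subst (1 2) fa_expand[of p]) (simp add: sum_distrib_left sum_distrib_right)
qed

lemma scal_left_commute: "p * (scal c * q) = scal c * (p * q)"
  by (metis mult.assoc scal_commute)

lemma fa_vector_space: "vector_space (\<lambda>c p. scal c * p :: ('g, 'k::field) free_algebra)"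
proof
  fix c c' :: 'k and p q :: "('g, 'k) free_algebra"
  show "scal c * (p + q) = scal c * p + scal c * q" by (rule distrib_left)
  show "scal (c + c') * p = scal c * p + scal c' * p" by (simp only: scal_add distrib_right)
  show "scal c * (scal c' * p) = scal (c * c') * p" by (simp only: scal_mult mult.assoc)
  show "scal 1 * p = p" by simp
qed

text \<open>Linear algebra on representatives uses the type-based span and subspace obtained here;
  \<open>span_pres_class\<close> carries spans over to the record-based quotient.\<close>

global_interpretation fa: vector_space "\<lambda>c p. scal c * p :: ('g, 'k::field) free_algebra"
  by (rule fa_vector_space)

lemma fa_span_words: "p \<in> fa.span {word_of w | w. Word w \<in> Poly_Mapping.keys p}"
proof -
  have "scal (Poly_Mapping.lookup p w) * word_of (letters w) \<in> fa.span {word_of w | w. Word w \<in> Poly_Mapping.keys p}"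
    if "w \<in> Poly_Mapping.keys p" for w
    using that by (intro fa.span_scale fa.span_base) (cases w, auto)
  then show ?thesis
    by (subst (1) fa_expand[of p]) (rule fa.span_sum)
qed

lemma word_of_append: "word_of (u @ v) = word_of u * word_of v"
  by (simp add: word_of_def mult_single plus_word_def)

lemma word_of_Nil [simp]: "word_of [] = 1"
  by (simp add: word_of_def zero_word_def[symmetric])

lemma word_of_Cons: "word_of (x # w) = gen_of x * word_of w"
  using word_of_append[of "[x]" w] by (simp add: gen_of_def)

text \<open>A word arises from 1 by left multiplications with generators, and words span. Spanning
  thus becomes stability under these multiplications.\<close>

lemma free_algebra_subspace_UNIV:
  assumes S: "fa.subspace S" and one: "1 \<in> S" and left: "\<And>x p. p \<in> S \<Longrightarrow> gen_of x * p \<in> S"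
  shows "p \<in> S"
proof -
  have "word_of w \<in> S" for w
    by (induction w) (simp_all add: one left word_of_Cons)
  then have "fa.span {word_of w | w. Word w \<in> Poly_Mapping.keys p} \<subseteq> S"
    by (intro fa.span_minimal S) auto
  with fa_span_words show ?thesis by blast
qed

section \<open>Two-sided ideals and quotients of the free algebra\<close>

definition two_sided_ideal :: "('g, 'k::field) free_algebra set \<Rightarrow> bool" where
  "two_sided_ideal J \<longleftrightarrow> 0 \<in> J \<and> (\<forall>x\<in>J. \<forall>y\<in>J. x + y \<in> J) \<and> (\<forall>x\<in>J. \<forall>p. p * x \<in> J \<and> x * p \<in> J)"

lemma free_alg_simps [simp]:
  "carrier free_alg = UNIV" "monoid.mult free_alg = (*)" "one free_alg = 1" "zero free_alg = 0"
  "add free_alg = (+)" "module.smult free_alg = (\<lambda>c p. scal c * p)"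
  by (simp_all add: free_alg_def)

lemma free_alg_ring: "ring (free_alg :: ('k::field, ('g, 'k) free_algebra) module)"
proof (intro ringI abelian_groupI monoidI)
  show "\<exists>y\<in>carrier free_alg. y \<oplus>\<^bsub>free_alg\<^esub> x = \<zero>\<^bsub>free_alg\<^esub>" for x :: "('g, 'k) free_algebra"
    by (auto intro!: exI[of _ "- x"])
qed (auto simp: algebra_simps)

text \<open>Negatives stay in \<open>J\<close> because \<open>- x\<close> is \<open>- 1\<close>
  times \<open>x\<close>; this supplies the subgroup condition of a library ideal.\<close>

lemma ideal_free_alg_iff: "ideal J free_alg \<longleftrightarrow> two_sided_ideal J"
proof
  assume "ideal J free_alg"
  then interpret ideal J free_alg .
  show "two_sided_ideal J"
    using I_l_closed I_r_closed additive_subgroup.zero_closed[OF is_additive_subgroup]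
      additive_subgroup.a_closed[OF is_additive_subgroup] by (auto simp: two_sided_ideal_def)
next
  assume J: "two_sided_ideal J"
  interpret ring "free_alg :: ('b, ('a, 'b) free_algebra) module" by (rule free_alg_ring)
  have neg: "- x \<in> J" if "x \<in> J" for x
    using J that unfolding two_sided_ideal_def by (metis mult_minus1)
  have "a_inv free_alg x = - x" for x :: "('a, 'b) free_algebra"
    using minus_equality[of "- x" x] by simp
  then have inv: "m_inv (add_monoid (free_alg :: ('b, ('a, 'b) free_algebra) module)) x = - x" for x
    by (simp add: a_inv_def)
  have "m_inv (add_monoid free_alg) x \<in> J" if "x \<in> J" for x
    unfolding inv using that by (rule neg)
  then have "subgroup J (add_monoid free_alg)"
    using J by (intro subgroup.intro) (auto simp: two_sided_ideal_def)
  then show "ideal J free_alg"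
    using J by (intro idealI[OF free_alg_ring]) (auto simp: two_sided_ideal_def)
qed

lemma rel_ideal_two_sided: "two_sided_ideal (rel_ideal R)"
  unfolding rel_ideal_def ideal_free_alg_iff[symmetric]
  by (rule ring.genideal_ideal[OF free_alg_ring]) simp

lemma rel_ideal_least: "two_sided_ideal J \<Longrightarrow> R \<subseteq> J \<Longrightarrow> rel_ideal R \<subseteq> J"
  unfolding rel_ideal_def ideal_free_alg_iff[symmetric]
  by (rule ring.genideal_minimal[OF free_alg_ring])

lemma rel_ideal_base: "r \<in> R \<Longrightarrow> r \<in> rel_ideal R"
  unfolding rel_ideal_def using ring.genideal_self[OF free_alg_ring, of R] by auto

lemma rel_ideal_zero [simp]: "0 \<in> rel_ideal R"
  and rel_ideal_add: "x \<in> rel_ideal R \<Longrightarrow> y \<in> rel_ideal R \<Longrightarrow> x + y \<in> rel_ideal R"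
  and rel_ideal_mult_left: "x \<in> rel_ideal R \<Longrightarrow> p * x \<in> rel_ideal R"
  and rel_ideal_mult_right: "x \<in> rel_ideal R \<Longrightarrow> x * p \<in> rel_ideal R"
  using rel_ideal_two_sided[of R] by (auto simp: two_sided_ideal_def)

lemma rel_ideal_uminus: "x \<in> rel_ideal R \<Longrightarrow> - x \<in> rel_ideal R"
  using rel_ideal_mult_left[of x R "- 1"] by simp

lemma rel_ideal_diff: "x \<in> rel_ideal R \<Longrightarrow> y \<in> rel_ideal R \<Longrightarrow> x - y \<in> rel_ideal R"
  using rel_ideal_add[OF _ rel_ideal_uminus] by fastforce

lemma rel_ideal_subspace: "fa.subspace (rel_ideal R)"
  by (simp add: fa.subspace_def rel_ideal_add rel_ideal_mult_left)

lemma rel_ideal_diff_commute: "x - y \<in> rel_ideal R \<Longrightarrow> y - x \<in> rel_ideal R"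
  using rel_ideal_uminus[of "x - y" R] by simp

lemma pres_class_eq: "pres_class R p = {x. x - p \<in> rel_ideal R}"
proof (intro equalityI subsetI)
  fix x assume "x \<in> {x. x - p \<in> rel_ideal R}"
  then show "x \<in> pres_class R p"
    by (auto simp: pres_class_def a_r_coset_def' intro!: bexI[of _ "x - p"])
qed (auto simp: pres_class_def a_r_coset_def')

lemma pres_class_eq_iff: "pres_class R p = pres_class R q \<longleftrightarrow> p - q \<in> rel_ideal R"
proof
  assume "pres_class R p = pres_class R q"
  then have "p \<in> pres_class R q" using pres_class_eq[of R p] by auto
  then show "p - q \<in> rel_ideal R" by (simp add: pres_class_eq)
next
  assume pq: "p - q \<in> rel_ideal R"
  have "x - p \<in> rel_ideal R \<longleftrightarrow> x - q \<in> rel_ideal R" for x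
    using rel_ideal_add[OF _ pq, of "x - p"] rel_ideal_diff[OF _ pq, of "x - q"] by auto
  then show "pres_class R p = pres_class R q" by (simp add: pres_class_eq)
qed

text \<open>All operations of the quotient are computed on representatives, so that later arguments
  concern only membership in \<open>rel_ideal R\<close>.\<close>

lemma presented_alg_simps:
  "carrier (presented_alg R) = range (pres_class R)"
  "pres_class R p \<otimes>\<^bsub>presented_alg R\<^esub> pres_class R q = pres_class R (p * q)"
  "pres_class R p \<oplus>\<^bsub>presented_alg R\<^esub> pres_class R q = pres_class R (p + q)"
  "\<one>\<^bsub>presented_alg R\<^esub> = pres_class R 1"
  "\<zero>\<^bsub>presented_alg R\<^esub> = pres_class R 0"
  "c \<odot>\<^bsub>presented_alg R\<^esub> pres_class R p = pres_class R (scal c * p)"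
proof -
  interpret ideal "rel_ideal R" free_alg
    by (simp add: ideal_free_alg_iff rel_ideal_two_sided)
  show "carrier (presented_alg R) = range (pres_class R)"
    by (auto simp: presented_alg_def quot_alg_def FactRing_def A_RCOSETS_def' pres_class_def)
  show "pres_class R p \<otimes>\<^bsub>presented_alg R\<^esub> pres_class R q = pres_class R (p * q)"
    using rcoset_mult_add[of p q]
    by (simp add: presented_alg_def quot_alg_def FactRing_def pres_class_def)
  show "pres_class R p \<oplus>\<^bsub>presented_alg R\<^esub> pres_class R q = pres_class R (p + q)"
    using a_rcos_sum[of p q]
    by (simp add: presented_alg_def quot_alg_def FactRing_def pres_class_def)
  show "\<one>\<^bsub>presented_alg R\<^esub> = pres_class R 1"
    by (simp add: presented_alg_def quot_alg_def FactRing_def pres_class_def)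
  show "\<zero>\<^bsub>presented_alg R\<^esub> = pres_class R 0"
    by (simp add: presented_alg_def quot_alg_def FactRing_def pres_class_eq)
  have "c \<odot>\<^bsub>presented_alg R\<^esub> pres_class R p = (\<Union>x\<in>pres_class R p. pres_class R (scal c * x))"
    by (simp add: presented_alg_def quot_alg_def pres_class_def)
  \<comment> \<open>Congruent representatives have congruent multiples, so the union defining the
    scalar product runs over copies of one coset.\<close>
  also have "\<dots> = (\<Union>x\<in>pres_class R p. pres_class R (scal c * p))"
    by (rule SUP_cong)
      (auto simp: pres_class_eq_iff pres_class_eq[of R p] right_diff_distrib[symmetric] rel_ideal_mult_left)
  also have "\<dots> = pres_class R (scal c * p)"
  proof -
    have "p \<in> pres_class R p" by (simp add: pres_class_eq)
    then show ?thesis by auto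
  qed
  finally show "c \<odot>\<^bsub>presented_alg R\<^esub> pres_class R p = pres_class R (scal c * p)" .
qed

lemma ring_of_type_algebra_simps [simp]:
  "carrier ring_of_type_algebra = UNIV" "monoid.mult ring_of_type_algebra = (*)"
  "one ring_of_type_algebra = 1" "zero ring_of_type_algebra = 0" "add ring_of_type_algebra = (+)"
  by (simp_all add: ring_of_type_algebra_def)

lemma presented_alg_assoc_algebra:
  fixes R :: "('g, 'k::field) free_algebra set"
  shows "assoc_algebra ring_of_type_algebra (presented_alg R)"
proof -
  have cr: "cring (ring_of_type_algebra :: 'k ring)" by (rule cring_from_type_algebra)
  have fld: "field (ring_of_type_algebra :: 'k ring)" by (rule field_from_type_algebra)
  have inv: "\<exists>y\<in>carrier (presented_alg R). y \<oplus>\<^bsub>presented_alg R\<^esub> x = \<zero>\<^bsub>presented_alg R\<^esub>"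
    if "x \<in> carrier (presented_alg R)" for x
  proof -
    from that obtain p where x: "x = pres_class R p" by (auto simp: presented_alg_simps)
    have "pres_class R (- p) \<oplus>\<^bsub>presented_alg R\<^esub> x = \<zero>\<^bsub>presented_alg R\<^esub>"
      by (simp add: x presented_alg_simps)
    then show ?thesis by (auto simp: presented_alg_simps(1))
  qed
  have ag: "abelian_group (presented_alg R)"
  proof (rule abelian_groupI)
    show "\<exists>y\<in>carrier (presented_alg R). y \<oplus>\<^bsub>presented_alg R\<^esub> x = \<zero>\<^bsub>presented_alg R\<^esub>"
      if "x \<in> carrier (presented_alg R)" for x
      using that by (rule inv)
  qed (auto simp: presented_alg_simps(1,3,5) ac_simps)
  have ri: "ring (presented_alg R)"
    by (rule ringI[OF ag monoidI]) (auto simp: presented_alg_simps algebra_simps)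
  have "module ring_of_type_algebra (presented_alg R)"
  proof (rule moduleI[OF cr ag])
    fix a b :: 'k and x y
    assume "x \<in> carrier (presented_alg R)" "y \<in> carrier (presented_alg R)"
    then obtain p q where [simp]: "x = pres_class R p" "y = pres_class R q"
      by (auto simp: presented_alg_simps(1))
    show "a \<odot>\<^bsub>presented_alg R\<^esub> (x \<oplus>\<^bsub>presented_alg R\<^esub> y) =
        a \<odot>\<^bsub>presented_alg R\<^esub> x \<oplus>\<^bsub>presented_alg R\<^esub> a \<odot>\<^bsub>presented_alg R\<^esub> y"
      by (simp add: presented_alg_simps distrib_left)
  next
    fix a b :: 'k and x
    assume "x \<in> carrier (presented_alg R)"
    then obtain p where [simp]: "x = pres_class R p"
      by (auto simp: presented_alg_simps(1))
    show "a \<odot>\<^bsub>presented_alg R\<^esub> x \<in> carrier (presented_alg R)"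
      by (simp add: presented_alg_simps)
    show "(a \<oplus>\<^bsub>ring_of_type_algebra\<^esub> b) \<odot>\<^bsub>presented_alg R\<^esub> x =
        a \<odot>\<^bsub>presented_alg R\<^esub> x \<oplus>\<^bsub>presented_alg R\<^esub> b \<odot>\<^bsub>presented_alg R\<^esub> x"
      by (simp add: presented_alg_simps scal_add distrib_right)
    show "(a \<otimes>\<^bsub>ring_of_type_algebra\<^esub> b) \<odot>\<^bsub>presented_alg R\<^esub> x =
        a \<odot>\<^bsub>presented_alg R\<^esub> (b \<odot>\<^bsub>presented_alg R\<^esub> x)"
      by (simp only: presented_alg_simps(6) \<open>x = pres_class R p\<close> ring_of_type_algebra_simps(2) scal_mult mult.assoc)
    show "\<one>\<^bsub>ring_of_type_algebra\<^esub> \<odot>\<^bsub>presented_alg R\<^esub> x = x"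
      by (simp add: presented_alg_simps(6))
  qed
  then show ?thesis
    by (intro assoc_algebra.intro vectorspace.intro assoc_algebra_axioms.intro fld ri)
      (auto simp: presented_alg_simps scal_left_commute mult.assoc)
qed

lemma presented_alg_vectorspace: "vectorspace ring_of_type_algebra (presented_alg R)"
  by (rule assoc_algebra.axioms(1)[OF presented_alg_assoc_algebra])

lemma presented_alg_module: "module ring_of_type_algebra (presented_alg R)"
  by (rule vectorspace.axioms(1)[OF presented_alg_vectorspace])

lemma finsum_pres_class:
  assumes "finite A"
  shows "(\<Oplus>\<^bsub>presented_alg R\<^esub>i\<in>A. pres_class R (f i)) = pres_class R (\<Sum>i\<in>A. f i)"
proof -
  interpret module ring_of_type_algebra "presented_alg R" by (rule presented_alg_module)
  show ?thesis using assms
    by (induction A) (auto simp: presented_alg_simps)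
qed

text \<open>Taking classes is linear: combinations of classes lift along chosen representatives, and
  conversely the preimage of a span is a subspace.\<close>

lemma span_pres_class:
  "module.span ring_of_type_algebra (presented_alg R) (pres_class R ` Y) = pres_class R ` fa.span Y"
proof -
  interpret module ring_of_type_algebra "presented_alg R" by (rule presented_alg_module)
  have Y: "pres_class R ` Y \<subseteq> carrier (presented_alg R)" by (auto simp: presented_alg_simps)
  interpret sp: submodule ring_of_type_algebra "span (pres_class R ` Y)" "presented_alg R"
    by (rule span_is_submodule[OF Y])
  show ?thesis
  proof (intro equalityI subsetI)
    fix v assume "v \<in> span (pres_class R ` Y)"
    then obtain a A where A: "finite A" "A \<subseteq> pres_class R ` Y" and v: "v = lincomb a A"
      by (auto simp: span_def)
    then have "\<forall>u\<in>A. \<exists>x. x \<in> Y \<and> u = pres_class R x" by blast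
    then obtain s where s: "\<forall>u\<in>A. s u \<in> Y \<and> u = pres_class R (s u)"
      by (rule bchoice[THEN exE])
    then have "a u \<odot>\<^bsub>presented_alg R\<^esub> u = pres_class R (scal (a u) * s u)" if "u \<in> A" for u
      using that by (metis presented_alg_simps(6))
    then have "v = (\<Oplus>\<^bsub>presented_alg R\<^esub>u\<in>A. pres_class R (scal (a u) * s u))"
      unfolding v lincomb_def by (intro finsum_cong') (auto simp: presented_alg_simps(1))
    also have "\<dots> = pres_class R (\<Sum>u\<in>A. scal (a u) * s u)"
      by (rule finsum_pres_class[OF A(1)])
    finally show "v \<in> pres_class R ` fa.span Y"
      using s by (auto intro!: imageI fa.span_sum fa.span_scale intro: fa.span_base)
  next
    fix v assume "v \<in> pres_class R ` fa.span Y"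
    then obtain p where p: "p \<in> fa.span Y" and v: "v = pres_class R p" by auto
    have "fa.subspace {p. pres_class R p \<in> span (pres_class R ` Y)}"
    proof (rule fa.subspaceI)
      show "0 \<in> {p. pres_class R p \<in> span (pres_class R ` Y)}"
        using sp.zero_closed by (simp add: presented_alg_simps)
      show "p + q \<in> {p. pres_class R p \<in> span (pres_class R ` Y)}"
        if "p \<in> {p. pres_class R p \<in> span (pres_class R ` Y)}"
          "q \<in> {p. pres_class R p \<in> span (pres_class R ` Y)}" for p q
        using sp.m_closed[of "pres_class R p" "pres_class R q"] that by (simp add: presented_alg_simps)
      show "scal c * p \<in> {p. pres_class R p \<in> span (pres_class R ` Y)}"
        if "p \<in> {p. pres_class R p \<in> span (pres_class R ` Y)}" for c p
        using sp.smult_closed[of c "pres_class R p"] that by (simp add: presented_alg_simps)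
    qed
    moreover have "Y \<subseteq> {p. pres_class R p \<in> span (pres_class R ` Y)}"
      using in_own_span[OF Y] by auto
    ultimately show "v \<in> span (pres_class R ` Y)"
      using fa.span_minimal p v by blast
  qed
qed

lemma presented_alg_subspace:
  assumes S: "fa.subspace S"
  shows "subspace ring_of_type_algebra (pres_class R ` S) (presented_alg R)"
proof -
  interpret module ring_of_type_algebra "presented_alg R" by (rule presented_alg_module)
  have "pres_class R ` S = span (pres_class R ` S)"
    by (simp only: span_pres_class fa.span_eq_iff[THEN iffD2, OF S])
  moreover have "submodule ring_of_type_algebra (span (pres_class R ` S)) (presented_alg R)"
    by (rule span_is_submodule) (auto simp: presented_alg_simps)
  ultimately show ?thesis
    by (simp add: subspace_def presented_alg_vectorspace)
qed

text \<open>Independence is stated for the family indexed by \<open>Y\<close>; it yields both that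
  the classes are distinct and that their set is independent.\<close>

lemma basis_pres_class:
  fixes R :: "('g, 'k::field) free_algebra set"
  assumes fin: "finite Y"
    and span: "\<And>p. \<exists>q\<in>fa.span (M ` Y). p - q \<in> rel_ideal R"
    and indep: "\<And>c. (\<Sum>t\<in>Y. scal (c t) * M t) \<in> rel_ideal R \<Longrightarrow> \<forall>t\<in>Y. c t = 0"
  shows "inj_on (\<lambda>t. pres_class R (M t)) Y"
    and "vectorspace.basis ring_of_type_algebra (presented_alg R) ((\<lambda>t. pres_class R (M t)) ` Y)"
proof -
  interpret V: vectorspace ring_of_type_algebra "presented_alg R" by (rule presented_alg_vectorspace)
  define m where "m = (\<lambda>t. pres_class R (M t))"
  show inj: "inj_on m Y"
  proof (rule inj_onI, rule ccontr)
    fix s t assume st: "s \<in> Y" "t \<in> Y" "m s = m t" "s \<noteq> t"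
    \<comment> \<open>Two indices with the same class would give a relation with coefficients 1 and
      -1.\<close>
    define c :: "_ \<Rightarrow> 'k" where "c = (\<lambda>u. if u = s then 1 else if u = t then - 1 else 0)"
    have "(\<Sum>u\<in>Y. scal (c u) * M u) = (\<Sum>u\<in>{s, t}. scal (c u) * M u)"
      using fin st by (intro sum.mono_neutral_right) (auto simp: c_def)
    also have "\<dots> = M s - M t"
      using st by (simp add: c_def scal_def single_uminus)
    also have "\<dots> \<in> rel_ideal R"
      using st(3) by (simp add: m_def pres_class_eq_iff)
    finally have "c s = 0" using indep st(1) by blast
    then show False by (simp add: c_def)
  qed
  have "\<not> V.lin_dep (m ` Y)"
  proof
    assume "V.lin_dep (m ` Y)"
    then obtain a v where a: "V.lincomb a (m ` Y) = \<zero>\<^bsub>presented_alg R\<^esub>" "v \<in> m ` Y" "a v \<noteq> 0"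
      using V.finite_lin_dep[of "m ` Y"] fin by (auto simp: presented_alg_simps m_def)
    have "V.lincomb a (m ` Y) = (\<Oplus>\<^bsub>presented_alg R\<^esub>t\<in>Y. a (m t) \<odot>\<^bsub>presented_alg R\<^esub> m t)"
      unfolding V.lincomb_def
      by (rule V.finsum_reindex[OF _ inj]) (auto simp: m_def presented_alg_simps)
    also have "\<dots> = pres_class R (\<Sum>t\<in>Y. scal (a (m t)) * M t)"
      by (simp add: m_def presented_alg_simps finsum_pres_class[OF fin])
    finally have "pres_class R (\<Sum>t\<in>Y. scal (a (m t)) * M t) = pres_class R 0"
      using a(1) by (simp add: presented_alg_simps)
    then have "(\<Sum>t\<in>Y. scal (a (m t)) * M t) \<in> rel_ideal R"
      by (simp only: pres_class_eq_iff diff_0_right)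
    with indep[of "\<lambda>t. a (m t)"] a show False by auto
  qed
  moreover have "V.span (m ` Y) = carrier (presented_alg R)"
  proof -
    have "V.span (m ` Y) = pres_class R ` fa.span (M ` Y)"
      using span_pres_class[of R "M ` Y"] by (simp add: m_def image_image)
    also have "\<dots> = range (pres_class R)"
    proof (intro equalityI subsetI)
      fix v assume "v \<in> range (pres_class R)"
      then obtain p where v: "v = pres_class R p" by auto
      from span[of p] obtain q where "q \<in> fa.span (M ` Y)" "p - q \<in> rel_ideal R" by blast
      then show "v \<in> pres_class R ` fa.span (M ` Y)"
        unfolding v using pres_class_eq_iff[of R p q] by blast
    qed auto
    finally show ?thesis by (simp add: presented_alg_simps)
  qed
  ultimately show "V.basis (m ` Y)"
    by (auto simp: V.basis_def m_def presented_alg_simps)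
qed

section \<open>Degrees\<close>

lemma length_letters_plus [simp]: "length (letters (u + v)) = length (letters u) + length (letters v)"
  by (simp add: plus_word_def)

lemma letters_zero [simp]: "letters 0 = []"
  by (simp add: zero_word_def)

definition homog :: "nat \<Rightarrow> ('g, 'k::field) free_algebra set" where
  "homog n = {p. \<forall>w\<in>Poly_Mapping.keys p. length (letters w) = n}"

text \<open>The strict bound makes \<open>degless 0\<close> the zero space, so the filtration piece
  of index n is the image of \<open>degless (Suc n)\<close> and its predecessor that of
  \<open>degless n\<close>, even for n = 0.\<close>

definition degless :: "nat \<Rightarrow> ('g, 'k::field) free_algebra set" where
  "degless n = {p. \<forall>w\<in>Poly_Mapping.keys p. length (letters w) < n}"

definition hcomp :: "nat \<Rightarrow> ('g, 'k::field) free_algebra \<Rightarrow> ('g, 'k) free_algebra" where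
  "hcomp n p = (\<Sum>w\<in>{w \<in> Poly_Mapping.keys p. length (letters w) = n}. Poly_Mapping.single w (Poly_Mapping.lookup p w))"

lemma lookup_hcomp:
  "Poly_Mapping.lookup (hcomp n p) w = (if length (letters w) = n then Poly_Mapping.lookup p w else 0)"
proof -
  have "Poly_Mapping.lookup (hcomp n p) w =
      (\<Sum>u\<in>{u \<in> Poly_Mapping.keys p. length (letters u) = n}. if u = w then Poly_Mapping.lookup p u else 0)"
    by (simp add: hcomp_def lookup_sum lookup_single when_def)
  also have "\<dots> = (if length (letters w) = n then Poly_Mapping.lookup p w else 0)"
    by (subst sum.delta) (auto simp: in_keys_iff)
  finally show ?thesis .
qed

lemma mem_homog: "p \<in> homog n \<longleftrightarrow> (\<forall>w. length (letters w) \<noteq> n \<longrightarrow> Poly_Mapping.lookup p w = 0)"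
  by (auto simp: homog_def in_keys_iff)

lemma mem_degless: "p \<in> degless n \<longleftrightarrow> (\<forall>w. length (letters w) \<ge> n \<longrightarrow> Poly_Mapping.lookup p w = 0)"
  by (auto simp: degless_def in_keys_iff not_le[symmetric])

lemma homog_subspace: "fa.subspace (homog n)"
  by (rule fa.subspaceI) (simp_all add: mem_homog lookup_add lookup_scal_mult)

lemma degless_subspace: "fa.subspace (degless n)"
  by (rule fa.subspaceI) (simp_all add: mem_degless lookup_add lookup_scal_mult)

lemma degless_0 [simp]: "degless 0 = {0}"
  by (auto simp: mem_degless intro: poly_mapping_eqI)

lemma degless_mono: "m \<le> n \<Longrightarrow> degless m \<subseteq> degless n"
  by (auto simp: mem_degless)

lemma homog_degless: "homog n \<subseteq> degless (Suc n)"
  by (auto simp: homog_def degless_def)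

lemma one_homog: "1 \<in> homog 0"
  by (simp add: homog_def)

lemma homog_mult: "p \<in> homog i \<Longrightarrow> q \<in> homog j \<Longrightarrow> p * q \<in> homog (i + j)"
  using keys_mult[of p q] by (force simp: homog_def)

text \<open>One factor has degree below \<open>i\<close> and the other at most \<open>j\<close>, so
  the product stays below \<open>i + j\<close>; \<open>degless_mult'\<close> is the mirror
  image.\<close>

lemma degless_mult: "p \<in> degless i \<Longrightarrow> q \<in> degless (Suc j) \<Longrightarrow> p * q \<in> degless (i + j)"
  using keys_mult[of p q] by (fastforce simp: degless_def)

lemma degless_mult': "p \<in> degless (Suc i) \<Longrightarrow> q \<in> degless j \<Longrightarrow> p * q \<in> degless (i + j)"
  using keys_mult[of p q] by (fastforce simp: degless_def)

lemma ex_degless: "\<exists>n. p \<in> degless n"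
proof -
  have "\<forall>w\<in>Poly_Mapping.keys p. length (letters w) < Suc (Max ((\<lambda>w. length (letters w)) ` Poly_Mapping.keys p))"
    by (auto simp: less_Suc_eq_le)
  then show ?thesis by (auto simp: degless_def)
qed

lemma hcomp_in_homog: "hcomp n p \<in> homog n"
  by (simp add: mem_homog lookup_hcomp)

lemma hcomp_homog: "p \<in> homog m \<Longrightarrow> hcomp n p = (if n = m then p else 0)"
  by (rule poly_mapping_eqI) (auto simp: lookup_hcomp mem_homog)

lemma hcomp_degless: "p \<in> degless m \<Longrightarrow> m \<le> n \<Longrightarrow> hcomp n p = 0"
  by (rule poly_mapping_eqI) (auto simp: lookup_hcomp mem_degless)

lemma hcomp_0 [simp]: "hcomp n 0 = 0"
  by (rule poly_mapping_eqI) (simp add: lookup_hcomp)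

lemma hcomp_add: "hcomp n (p + q) = hcomp n p + hcomp n q"
  by (rule poly_mapping_eqI) (simp add: lookup_hcomp lookup_add)

lemma hcomp_diff: "hcomp n (p - q) = hcomp n p - hcomp n q"
  by (rule poly_mapping_eqI) (simp add: lookup_hcomp lookup_minus)

lemma hcomp_scal: "hcomp n (scal c * p) = scal c * hcomp n p"
  by (rule poly_mapping_eqI) (simp add: lookup_hcomp lookup_scal_mult)

lemma hcomp_sum: "hcomp n (\<Sum>i\<in>A. f i) = (\<Sum>i\<in>A. hcomp n (f i))"
  by (induction A rule: infinite_finite_induct) (simp_all add: hcomp_add)

lemma hcomp_hcomp: "hcomp m (hcomp n p) = (if m = n then hcomp n p else 0)"
  by (rule hcomp_homog[OF hcomp_in_homog])

lemma hcomp_expand: "p \<in> degless n \<Longrightarrow> (\<Sum>i<n. hcomp i p) = p"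
  by (rule poly_mapping_eqI) (auto simp: lookup_sum lookup_hcomp mem_degless not_less)

lemma degless_Suc_minus_hcomp: "p \<in> degless (Suc n) \<Longrightarrow> p - hcomp n p \<in> degless n"
  by (auto simp: mem_degless lookup_minus lookup_hcomp)

text \<open>Both factors are expanded into homogeneous components; only pairs of degrees with sum n
  contribute.\<close>

lemma hcomp_mult: "hcomp n (p * q) = (\<Sum>i\<le>n. hcomp i p * hcomp (n - i) q)"
proof -
  obtain a b where "p \<in> degless a" "q \<in> degless b" using ex_degless by metis
  then have pq: "p \<in> degless (a + b + Suc n)" "q \<in> degless (a + b + Suc n)"
    using degless_mono[of a "a + b + Suc n"] degless_mono[of b "a + b + Suc n"] by auto
  \<comment> \<open>\<open>N\<close> bounds both degrees and exceeds n, so that each complementary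
    degree \<open>n - i\<close> occurs in the summation range.\<close>
  define N where "N = a + b + Suc n"
  have "hcomp n (p * q) = hcomp n ((\<Sum>i<N. hcomp i p) * (\<Sum>j<N. hcomp j q))"
    using pq by (simp only: hcomp_expand N_def)
  also have "\<dots> = (\<Sum>i<N. \<Sum>j<N. hcomp n (hcomp i p * hcomp j q))"
    by (simp add: sum_product hcomp_sum)
  also have "\<dots> = (\<Sum>i<N. \<Sum>j<N. if n = i + j then hcomp i p * hcomp j q else 0)"
    by (simp add: hcomp_homog[OF homog_mult[OF hcomp_in_homog hcomp_in_homog]])
  also have "\<dots> = (\<Sum>i<N. if i \<le> n then hcomp i p * hcomp (n - i) q else 0)"
  proof (rule sum.cong)
    fix i
    show "(\<Sum>j<N. if n = i + j then hcomp i p * hcomp j q else 0) =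
        (if i \<le> n then hcomp i p * hcomp (n - i) q else 0)"
    proof (cases "i \<le> n")
      case True
      then have "(\<Sum>j<N. if n = i + j then hcomp i p * hcomp j q else 0) =
          (\<Sum>j<N. if j = n - i then hcomp i p * hcomp j q else 0)"
        by (intro sum.cong) auto
      moreover have "n - i < N" by (simp add: N_def)
      ultimately show ?thesis using True by simp
    qed simp
  qed simp
  also have "\<dots> = (\<Sum>i\<le>n. hcomp i p * hcomp (n - i) q)"
    by (rule sum.mono_neutral_cong_right) (auto simp: N_def)
  finally show ?thesis .
qed

section \<open>Grading and filtration by word length\<close>

lemma span_words_homog: "fa.span (word_of ` {w. length w = n}) = homog n"
proof (intro equalityI subsetI)
  fix p assume "p \<in> fa.span (word_of ` {w. length w = n})"
  moreover have "word_of ` {w. length w = n} \<subseteq> homog n"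
    by (auto simp: homog_def word_of_def)
  ultimately show "p \<in> homog n"
    using fa.span_minimal[OF _ homog_subspace] by blast
next
  fix p :: "('a, 'b) free_algebra" assume "p \<in> homog n"
  then have "{word_of w | w. Word w \<in> Poly_Mapping.keys p} \<subseteq> word_of ` {w. length w = n}"
    by (auto simp: homog_def)
  from fa.span_mono[OF this] show "p \<in> fa.span (word_of ` {w. length w = n})"
    using fa_span_words[of p] by auto
qed

lemma span_words_degless: "fa.span (word_of ` {w. length w \<le> n}) = degless (Suc n)"
proof (intro equalityI subsetI)
  fix p assume "p \<in> fa.span (word_of ` {w. length w \<le> n})"
  moreover have "word_of ` {w. length w \<le> n} \<subseteq> degless (Suc n)"
    by (auto simp: degless_def word_of_def)
  ultimately show "p \<in> degless (Suc n)"
    using fa.span_minimal[OF _ degless_subspace] by blast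
next
  fix p :: "('a, 'b) free_algebra" assume "p \<in> degless (Suc n)"
  then have "{word_of w | w. Word w \<in> Poly_Mapping.keys p} \<subseteq> word_of ` {w. length w \<le> n}"
    by (auto simp: degless_def)
  from fa.span_mono[OF this] show "p \<in> fa.span (word_of ` {w. length w \<le> n})"
    using fa_span_words[of p] by auto
qed

lemma word_grading_eq: "word_grading R n = pres_class R ` homog n"
proof -
  have "{pres_class R (word_of w) | w. length w = n} = pres_class R ` word_of ` {w. length w = n}" by auto
  then show ?thesis
    by (simp only: word_grading_def span_pres_class span_words_homog)
qed

lemma word_filtration_eq: "word_filtration R n = pres_class R ` degless (Suc n)"
proof -
  have "{pres_class R (word_of w) | w. length w \<le> n} = pres_class R ` word_of ` {w. length w \<le> n}" by auto
  then show ?thesis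
    by (simp only: word_filtration_def span_pres_class span_words_degless)
qed

lemma filt_pred_eq: "filt_pred (presented_alg R) (word_filtration R) n = pres_class R ` degless n"
  by (cases n) (simp_all add: filt_pred_def presented_alg_simps word_filtration_eq)

lemma word_filtration_filtered:
  fixes R :: "('g, 'k::field) free_algebra set"
  shows "filtered_algebra ring_of_type_algebra (presented_alg R) (word_filtration R)"
proof (intro filtered_algebra.intro filtered_algebra_axioms.intro presented_alg_assoc_algebra)
  show "subspace ring_of_type_algebra (word_filtration R n) (presented_alg R)" for n
    unfolding word_filtration_eq by (rule presented_alg_subspace[OF degless_subspace])
  show "word_filtration R n \<subseteq> word_filtration R (Suc n)" for n
    unfolding word_filtration_eq by (intro image_mono degless_mono) simp
  have "\<exists>n. p \<in> degless (Suc n)" for p :: "('g, 'k) free_algebra"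
    using ex_degless[of p] degless_mono[of _ "Suc _"] by (meson le_SucI order_refl subsetD)
  then have "(\<Union>n. pres_class R ` degless (Suc n)) = range (pres_class R)" by blast
  then show "(\<Union>n. word_filtration R n) = carrier (presented_alg R)"
    by (simp only: word_filtration_eq presented_alg_simps)
  show "\<one>\<^bsub>presented_alg R\<^esub> \<in> word_filtration R 0"
    unfolding word_filtration_eq presented_alg_simps using one_homog homog_degless by blast
  show "x \<otimes>\<^bsub>presented_alg R\<^esub> y \<in> word_filtration R (i + j)"
    if "x \<in> word_filtration R i" "y \<in> word_filtration R j" for x y i j
  proof -
    from that obtain p q where "x = pres_class R p" "y = pres_class R q"
      "p \<in> degless (Suc i)" "q \<in> degless (Suc j)"
      by (auto simp: word_filtration_eq)
    then show ?thesis
      using degless_mult[of p "Suc i" q j] by (simp add: word_filtration_eq presented_alg_simps)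
  qed
qed

text \<open>The elements all of whose homogeneous components lie in the ideal form a two-sided
  ideal, by the product formula for components, and it contains the homogeneous relations.\<close>

lemma hcomp_rel_ideal:
  assumes "\<And>r. r \<in> R \<Longrightarrow> \<exists>n. r \<in> homog n" and p: "p \<in> rel_ideal R"
  shows "hcomp n p \<in> rel_ideal R"
proof -
  define J where "J = {p. \<forall>n. hcomp n p \<in> rel_ideal R}"
  have "two_sided_ideal J"
    unfolding two_sided_ideal_def
  proof (intro conjI ballI allI)
    show "x + y \<in> J" if "x \<in> J" "y \<in> J" for x y
      using that by (simp add: J_def hcomp_add rel_ideal_add)
    show "q * x \<in> J" if "x \<in> J" for x q
      using that by (auto simp: J_def hcomp_mult intro!: fa.subspace_sum[OF rel_ideal_subspace] rel_ideal_mult_left)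
    show "x * q \<in> J" if "x \<in> J" for x q
      using that by (auto simp: J_def hcomp_mult intro!: fa.subspace_sum[OF rel_ideal_subspace] rel_ideal_mult_right)
  qed (simp add: J_def)
  moreover have "R \<subseteq> J"
  proof
    fix r assume r: "r \<in> R"
    then obtain n where "r \<in> homog n" using assms(1) by blast
    with r show "r \<in> J" by (simp add: J_def hcomp_homog rel_ideal_base)
  qed
  ultimately show ?thesis
    using rel_ideal_least[of J R] p by (auto simp: J_def)
qed

text \<open>Existence takes the components of a representative; uniqueness holds because the ideal
  contains every component of its members.\<close>

lemma word_grading_graded:
  assumes R: "\<And>r. r \<in> R \<Longrightarrow> \<exists>n. r \<in> homog n"
  shows "graded_algebra ring_of_type_algebra (presented_alg R) (word_grading R)"
proof (intro graded_algebra.intro graded_algebra_axioms.intro presented_alg_assoc_algebra)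
  show "subspace ring_of_type_algebra (word_grading R n) (presented_alg R)" for n
    unfolding word_grading_eq by (rule presented_alg_subspace[OF homog_subspace])
  show "\<one>\<^bsub>presented_alg R\<^esub> \<in> word_grading R 0"
    unfolding word_grading_eq presented_alg_simps using one_homog by blast
  show "x \<otimes>\<^bsub>presented_alg R\<^esub> y \<in> word_grading R (i + j)"
    if "x \<in> word_grading R i" "y \<in> word_grading R j" for x y i j
  proof -
    from that obtain p q where "x = pres_class R p" "y = pres_class R q" "p \<in> homog i" "q \<in> homog j"
      by (auto simp: word_grading_eq)
    then show ?thesis
      using homog_mult[of p i q j] by (simp add: word_grading_eq presented_alg_simps)
  qed
  fix x assume "x \<in> carrier (presented_alg R)"
  then obtain p where x: "x = pres_class R p" by (auto simp: presented_alg_simps)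
  obtain N where N: "p \<in> degless N" using ex_degless by blast
  let ?supp = "\<lambda>f. {n. f n \<noteq> \<zero>\<^bsub>presented_alg R\<^esub>}"
  define f where "f = (\<lambda>n. pres_class R (hcomp n p))"
  have supp_f: "n \<notin> ?supp f \<longleftrightarrow> hcomp n p \<in> rel_ideal R" for n
    by (simp add: f_def presented_alg_simps pres_class_eq_iff)
  have sub: "?supp f \<subseteq> {..<N}"
    using hcomp_degless[OF N] by (auto simp: f_def presented_alg_simps not_le[symmetric])
  have fin: "finite (?supp f)" by (rule finite_subset[OF sub]) simp
  \<comment> \<open>Components outside the support lie in the ideal, so leaving them out does not
    change the class.\<close>
  have "p - (\<Sum>n\<in>?supp f. hcomp n p) = (\<Sum>n\<in>{..<N} - ?supp f. hcomp n p)"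
    using sub hcomp_expand[OF N] by (simp add: sum_diff)
  also have "\<dots> \<in> rel_ideal R"
    using supp_f by (intro fa.subspace_sum[OF rel_ideal_subspace]) blast
  finally have "x = pres_class R (\<Sum>n\<in>?supp f. hcomp n p)"
    by (simp add: x pres_class_eq_iff)
  also have "\<dots> = (\<Oplus>\<^bsub>presented_alg R\<^esub>n\<in>?supp f. f n)"
    unfolding f_def by (rule finsum_pres_class[symmetric]) (use fin in \<open>simp add: f_def\<close>)
  finally have xf: "x = (\<Oplus>\<^bsub>presented_alg R\<^esub>n\<in>?supp f. f n)" .
  show "\<exists>!f. (\<forall>n. f n \<in> word_grading R n) \<and> finite (?supp f) \<and>
      x = (\<Oplus>\<^bsub>presented_alg R\<^esub>n\<in>?supp f. f n)"
  proof (rule ex1I[of _ f])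
    show "(\<forall>n. f n \<in> word_grading R n) \<and> finite (?supp f) \<and>
        x = (\<Oplus>\<^bsub>presented_alg R\<^esub>n\<in>?supp f. f n)"
      using xf fin hcomp_in_homog by (auto simp: f_def word_grading_eq)
  next
    fix g assume g: "(\<forall>n. g n \<in> word_grading R n) \<and> finite (?supp g) \<and>
        x = (\<Oplus>\<^bsub>presented_alg R\<^esub>n\<in>?supp g. g n)"
    then have "\<forall>n. \<exists>s. s \<in> homog n \<and> g n = pres_class R s"
      by (auto simp: word_grading_eq)
    then obtain s where s: "\<And>n. s n \<in> homog n" and gs: "\<And>n. g n = pres_class R (s n)"
      by metis
    have "x = (\<Oplus>\<^bsub>presented_alg R\<^esub>n\<in>?supp g. pres_class R (s n))"
      using g by (simp only: gs)
    also have "\<dots> = pres_class R (\<Sum>n\<in>?supp g. s n)"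
      by (rule finsum_pres_class) (use g in simp)
    finally have diff: "p - (\<Sum>n\<in>?supp g. s n) \<in> rel_ideal R"
      by (simp add: x pres_class_eq_iff)
    have "g m = f m" for m
    proof -
      \<comment> \<open>Comparing degree \<open>m\<close> isolates the single summand
        \<open>s m\<close>, present only when \<open>m\<close> lies in the support.\<close>
      have "hcomp m (p - (\<Sum>n\<in>?supp g. s n)) = hcomp m p - (\<Sum>n\<in>?supp g. if n = m then s n else 0)"
        by (simp add: hcomp_diff hcomp_sum hcomp_homog[OF s] eq_commute[of m])
      also have "\<dots> = hcomp m p - (if m \<in> ?supp g then s m else 0)"
        using g by (subst sum.delta) auto
      finally have m: "hcomp m p - (if m \<in> ?supp g then s m else 0) \<in> rel_ideal R"
        using hcomp_rel_ideal[OF R diff, of m] by simp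
      show ?thesis
      proof (cases "m \<in> ?supp g")
        case True
        with m have "hcomp m p - s m \<in> rel_ideal R" by simp
        then show ?thesis by (simp add: f_def gs pres_class_eq_iff rel_ideal_diff_commute)
      next
        case False
        with m have "hcomp m p \<in> rel_ideal R" by simp
        then have "f m = \<zero>\<^bsub>presented_alg R\<^esub>" using supp_f[of m] by simp
        with False show ?thesis by simp
      qed
    qed
    then show "g = f" ..
  qed
qed

section \<open>A criterion for PBW deformations\<close>

lemma fa_span_image:
  assumes "finite Y" and "q \<in> fa.span (N ` Y)"
  shows "\<exists>c. q = (\<Sum>t\<in>Y. scal (c t) * N t)"
  using assms(2)
proof (induction rule: fa.span_induct_alt)
  case base
  show ?case by (rule exI[of _ "\<lambda>_. 0"]) simp
next
  case (step k x q)
  then obtain u c where u: "u \<in> Y" "x = N u" and c: "q = (\<Sum>t\<in>Y. scal (c t) * N t)" by auto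
  have "scal k * N u = (\<Sum>t\<in>Y. scal (if t = u then k else 0) * N t)"
    using assms(1) u by (simp add: if_distrib[of scal] if_distrib[of "\<lambda>z. z * _"] cong: if_cong)
  then show ?case
    unfolding c u
    by (intro exI[of _ "\<lambda>t. (if t = u then k else 0) + c t"])
      (simp only: scal_add distrib_right sum.distrib)
qed

text \<open>\<open>RB\<close> holds homogeneous relations and \<open>RT\<close> their deformations;
  the homogeneous elements \<open>N\<close> span modulo \<open>RB\<close>, and the \<open>M\<close>,
  with leading forms \<open>N\<close>, are independent modulo \<open>RT\<close>. This replaces a
  dimension count.\<close>

locale pbw_data =
  fixes RB RT :: "('g, 'k::field) free_algebra set"
    and Y :: "'t set" and M N :: "'t \<Rightarrow> ('g, 'k) free_algebra" and deg :: "'t \<Rightarrow> nat"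
  assumes fin: "finite Y"
    and rels: "r \<in> RB \<Longrightarrow> \<exists>n. r \<in> homog n \<and> (\<exists>s\<in>degless n. r - s \<in> rel_ideal RT)"
    and N_homog: "t \<in> Y \<Longrightarrow> N t \<in> homog (deg t)"
    and N_span: "\<exists>q\<in>fa.span (N ` Y). p - q \<in> rel_ideal RB"
    and M_minus_N: "t \<in> Y \<Longrightarrow> M t - N t \<in> degless (deg t)"
    and M_indep: "(\<Sum>t\<in>Y. scal (c t) * M t) \<in> rel_ideal RT \<Longrightarrow> \<forall>t\<in>Y. c t = 0"
begin

text \<open>The preimage in the free algebra of the filtration piece of index n - 1, zero for n = 0.
  Equality in degree n of the associated graded algebra becomes membership in
  \<open>low n\<close>.\<close>

definition low :: "nat \<Rightarrow> ('g, 'k) free_algebra set" where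
  "low n = {p. \<exists>s\<in>degless n. p - s \<in> rel_ideal RT}"

lemma low_subspace: "fa.subspace (low n)"
proof (rule fa.subspaceI)
  show "0 \<in> low n"
    using fa.subspace_0[OF degless_subspace] by (force simp: low_def)
next
  fix x y assume "x \<in> low n" "y \<in> low n"
  then obtain s s' where s: "s \<in> degless n" "x - s \<in> rel_ideal RT" "s' \<in> degless n" "y - s' \<in> rel_ideal RT"
    by (auto simp: low_def)
  then have "x + y - (s + s') \<in> rel_ideal RT"
    using rel_ideal_add[of "x - s" RT "y - s'"] by (simp add: algebra_simps)
  with s show "x + y \<in> low n"
    using fa.subspace_add[OF degless_subspace] by (auto simp: low_def)
next
  fix c x assume "x \<in> low n"
  then obtain s where s: "s \<in> degless n" "x - s \<in> rel_ideal RT"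
    by (auto simp: low_def)
  then have "scal c * x - scal c * s \<in> rel_ideal RT"
    using rel_ideal_mult_left[of "x - s" RT "scal c"] by (simp add: right_diff_distrib)
  with s show "scal c * x \<in> low n"
    using fa.subspace_scale[OF degless_subspace] by (auto simp: low_def)
qed

lemma degless_low: "p \<in> degless n \<Longrightarrow> p \<in> low n"
  by (auto simp: low_def intro!: bexI[of _ p])

lemma rel_ideal_low: "p \<in> rel_ideal RT \<Longrightarrow> p \<in> low n"
  using fa.subspace_0[OF degless_subspace] by (auto simp: low_def intro!: bexI[of _ 0])

lemma low_mult: "p \<in> low i \<Longrightarrow> q \<in> low (Suc j) \<Longrightarrow> p * q \<in> low (i + j)"
  and low_mult': "p \<in> low (Suc i) \<Longrightarrow> q \<in> low j \<Longrightarrow> p * q \<in> low (i + j)"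
proof -
  have *: "p * q - s * s' \<in> rel_ideal RT"
    if "p - s \<in> rel_ideal RT" "q - s' \<in> rel_ideal RT" for p q s s'
    using rel_ideal_add[OF rel_ideal_mult_right[OF that(1), of q] rel_ideal_mult_left[OF that(2), of s]]
    by (simp add: algebra_simps)
  show "p \<in> low i \<Longrightarrow> q \<in> low (Suc j) \<Longrightarrow> p * q \<in> low (i + j)"
    unfolding low_def using * degless_mult by blast
  show "p \<in> low (Suc i) \<Longrightarrow> q \<in> low j \<Longrightarrow> p * q \<in> low (i + j)"
    unfolding low_def using * degless_mult' by blast
qed

lemma homog_low: "p \<in> homog n \<Longrightarrow> p \<in> low (Suc n)"
  using homog_degless degless_low by blast

lemma RB_homog: "r \<in> RB \<Longrightarrow> \<exists>n. r \<in> homog n"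
  using rels by blast

text \<open>This makes the map from the graded algebra to the associated graded one well defined:
  the elements whose components all drop in degree modulo \<open>RT\<close> form an ideal containing
  \<open>RB\<close>.\<close>

lemma hcomp_ideal_low:
  assumes "p \<in> rel_ideal RB"
  shows "hcomp n p \<in> low n"
proof -
  define J where "J = {p. \<forall>n. hcomp n p \<in> low n}"
  have "two_sided_ideal J"
    unfolding two_sided_ideal_def
  proof (intro conjI ballI allI)
    show "0 \<in> J" using fa.subspace_0[OF low_subspace] by (simp add: J_def)
    show "x + y \<in> J" if "x \<in> J" "y \<in> J" for x y
      using that fa.subspace_add[OF low_subspace] by (simp add: J_def hcomp_add)
  next
    fix x q assume x: "x \<in> J"
    have "hcomp i q * hcomp (n - i) x \<in> low n" if "i \<le> n" for i n
      using low_mult'[OF homog_low[OF hcomp_in_homog], of "hcomp (n - i) x" "n - i" i q] that x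
      by (simp add: J_def)
    then show "q * x \<in> J"
      by (auto simp: J_def hcomp_mult intro!: fa.subspace_sum[OF low_subspace])
    have "hcomp i x * hcomp (n - i) q \<in> low n" if "i \<le> n" for i n
      using low_mult[OF _ homog_low[OF hcomp_in_homog], of "hcomp i x" i "n - i" q] that x
      by (simp add: J_def)
    then show "x * q \<in> J"
      by (auto simp: J_def hcomp_mult intro!: fa.subspace_sum[OF low_subspace])
  qed
  moreover have "RB \<subseteq> J"
  proof
    fix r assume "r \<in> RB"
    then obtain n where "r \<in> homog n" "\<exists>s\<in>degless n. r - s \<in> rel_ideal RT"
      using rels by blast
    then have "r \<in> homog n" "r \<in> low n" by (simp_all add: low_def)
    then show "r \<in> J"
      using fa.subspace_0[OF low_subspace] by (simp add: J_def hcomp_homog)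
  qed
  ultimately show ?thesis
    using rel_ideal_least[of J RB] assms by (auto simp: J_def)
qed

text \<open>The ideal of \<open>RB\<close> is homogeneous, so the component of degree n of an
  expansion in the \<open>N t\<close> may be taken, leaving only the terms of that degree.\<close>

lemma homog_expand:
  assumes "h \<in> homog n"
  shows "\<exists>c. h - (\<Sum>t\<in>{t \<in> Y. deg t = n}. scal (c t) * N t) \<in> rel_ideal RB"
proof -
  obtain q where q: "q \<in> fa.span (N ` Y)" "h - q \<in> rel_ideal RB" using N_span by blast
  obtain c where c: "q = (\<Sum>t\<in>Y. scal (c t) * N t)" using fa_span_image[OF fin q(1)] by blast
  have "hcomp n (h - q) = h - (\<Sum>t\<in>Y. scal (c t) * hcomp n (N t))"
    using assms by (simp add: c hcomp_diff hcomp_sum hcomp_scal hcomp_homog)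
  also have "(\<Sum>t\<in>Y. scal (c t) * hcomp n (N t)) = (\<Sum>t\<in>{t \<in> Y. deg t = n}. scal (c t) * N t)"
    using fin by (intro sum.mono_neutral_cong_right) (auto simp: hcomp_homog[OF N_homog])
  finally show ?thesis
    using hcomp_rel_ideal[OF RB_homog q(2), of n] by auto
qed

text \<open>Induction on the degree. The top component is expanded in the \<open>N t\<close> modulo
  \<open>RB\<close>; the error in that ideal drops in degree modulo \<open>RT\<close>, and
  exchanging \<open>N t\<close> for \<open>M t\<close> costs only lower terms.\<close>

lemma degless_expand: "p \<in> degless n \<Longrightarrow> \<exists>q\<in>fa.span (M ` {t \<in> Y. deg t < n}). p - q \<in> rel_ideal RT"
proof (induction n arbitrary: p)
  case 0
  then show ?case by simp
next
  case (Suc n)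
  let ?Z = "{t \<in> Y. deg t = n}"
  obtain c where c: "hcomp n p - (\<Sum>t\<in>?Z. scal (c t) * N t) \<in> rel_ideal RB"
    using homog_expand[OF hcomp_in_homog] by blast
  define i where "i = hcomp n p - (\<Sum>t\<in>?Z. scal (c t) * N t)"
  have "i \<in> homog n"
    unfolding i_def
    by (intro fa.subspace_diff fa.subspace_sum fa.subspace_scale homog_subspace hcomp_in_homog)
      (auto dest: N_homog)
  with hcomp_ideal_low[OF c, of n] have "i \<in> low n"
    by (simp add: hcomp_homog i_def[symmetric])
  then obtain s where s: "s \<in> degless n" "i - s \<in> rel_ideal RT" by (auto simp: low_def)
  \<comment> \<open>\<open>r\<close> collects what remains below degree \<open>n\<close> after the
    top component is replaced by the \<open>M t\<close> of degree \<open>n\<close>.\<close>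
  define r where "r = p - hcomp n p + s - (\<Sum>t\<in>?Z. scal (c t) * (M t - N t))"
  have "(\<Sum>t\<in>?Z. scal (c t) * (M t - N t)) \<in> degless n"
    by (intro fa.subspace_sum fa.subspace_scale degless_subspace) (auto dest: M_minus_N)
  then have "r \<in> degless n"
    unfolding r_def
    by (rule fa.subspace_diff[OF degless_subspace fa.subspace_add[OF degless_subspace
        degless_Suc_minus_hcomp[OF Suc.prems] s(1)]])
  then obtain q where q: "q \<in> fa.span (M ` {t \<in> Y. deg t < n})" "r - q \<in> rel_ideal RT"
    using Suc.IH by blast
  let ?q = "q + (\<Sum>t\<in>?Z. scal (c t) * M t)"
  have "p - ?q = (i - s) + (r - q)"
    by (simp add: i_def r_def right_diff_distrib sum_subtractf)
  then have "p - ?q \<in> rel_ideal RT"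
    by (simp only: rel_ideal_add[OF s(2) q(2)])
  moreover have "?q \<in> fa.span (M ` {t \<in> Y. deg t < Suc n})"
    using q(1) fa.span_mono[of "M ` {t \<in> Y. deg t < n}" "M ` {t \<in> Y. deg t < Suc n}"]
    by (intro fa.span_add fa.span_sum fa.span_scale) (auto intro: fa.span_base less_SucI)
  ultimately show ?case by blast
qed

text \<open>Injectivity of the map to the associated graded algebra. If \<open>h\<close> drops in
  degree, so does the combination of the \<open>M t\<close> of degree n that expands it; rewriting
  it in \<open>M t\<close> of smaller degree and using independence makes its coefficients
  vanish.\<close>

lemma homog_low_ideal:
  assumes "h \<in> homog n" "h \<in> low n"
  shows "h \<in> rel_ideal RB"
proof -
  let ?Z = "{t \<in> Y. deg t = n}" and ?W = "{t \<in> Y. deg t < n}"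
  obtain c where c: "h - (\<Sum>t\<in>?Z. scal (c t) * N t) \<in> rel_ideal RB"
    using homog_expand[OF assms(1)] by blast
  define i where "i = h - (\<Sum>t\<in>?Z. scal (c t) * N t)"
  have "i \<in> homog n"
    unfolding i_def using assms(1)
    by (intro fa.subspace_diff fa.subspace_sum fa.subspace_scale homog_subspace)
      (auto dest: N_homog)
  with hcomp_ideal_low[OF c, of n] have "i \<in> low n"
    by (simp add: hcomp_homog i_def[symmetric])
  have "(\<Sum>t\<in>?Z. scal (c t) * (M t - N t)) \<in> low n"
    by (intro fa.subspace_sum fa.subspace_scale low_subspace) (auto intro: degless_low dest: M_minus_N)
  then have "h - i + (\<Sum>t\<in>?Z. scal (c t) * (M t - N t)) \<in> low n"
    by (rule fa.subspace_add[OF low_subspace fa.subspace_diff[OF low_subspace assms(2) \<open>i \<in> low n\<close>]])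
  also have "h - i + (\<Sum>t\<in>?Z. scal (c t) * (M t - N t)) = (\<Sum>t\<in>?Z. scal (c t) * M t)"
    by (simp add: i_def right_diff_distrib sum_subtractf)
  finally obtain s where s: "s \<in> degless n" "(\<Sum>t\<in>?Z. scal (c t) * M t) - s \<in> rel_ideal RT"
    by (auto simp: low_def)
  obtain q where q: "q \<in> fa.span (M ` ?W)" "s - q \<in> rel_ideal RT"
    using degless_expand[OF s(1)] by blast
  obtain b where b: "q = (\<Sum>t\<in>?W. scal (b t) * M t)"
    using fa_span_image[OF _ q(1)] fin by auto
  \<comment> \<open>The two combinations run over disjoint sets of indices, of degree n and below n,
    so \<open>a t = 0\<close> gives \<open>c t = 0\<close> in degree n.\<close>
  define a where "a = (\<lambda>t. (if deg t = n then c t else 0) - (if deg t < n then b t else 0))"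
  have "(\<Sum>t\<in>Y. scal (a t) * M t) =
      (\<Sum>t\<in>Y. scal (if deg t = n then c t else 0) * M t) - (\<Sum>t\<in>Y. scal (if deg t < n then b t else 0) * M t)"
    by (simp only: a_def scal_def single_diff left_diff_distrib sum_subtractf)
  also have "(\<Sum>t\<in>Y. scal (if deg t = n then c t else 0) * M t) = (\<Sum>t\<in>?Z. scal (c t) * M t)"
    using fin by (intro sum.mono_neutral_cong_right) auto
  also have "(\<Sum>t\<in>Y. scal (if deg t < n then b t else 0) * M t) = q"
    unfolding b using fin by (intro sum.mono_neutral_cong_right) auto
  finally have "(\<Sum>t\<in>Y. scal (a t) * M t) = ((\<Sum>t\<in>?Z. scal (c t) * M t) - s) + (s - q)"
    by simp
  then have "\<forall>t\<in>Y. a t = 0"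
    using rel_ideal_add[OF s(2) q(2)] by (intro M_indep) simp
  then have "(\<Sum>t\<in>?Z. scal (c t) * N t) = 0"
    by (intro sum.neutral) (auto simp: a_def)
  with c show ?thesis by simp
qed

text \<open>Describes the kernel of the map \<open>symb\<close> below, one homogeneous component at
  a time.\<close>

lemma rel_ideal_iff_low: "p \<in> rel_ideal RB \<longleftrightarrow> (\<forall>n. hcomp n p \<in> low n)"
proof
  assume "\<forall>n. hcomp n p \<in> low n"
  then have "hcomp n p \<in> rel_ideal RB" for n
    using homog_low_ideal[OF hcomp_in_homog] by blast
  moreover obtain m where "p \<in> degless m" using ex_degless by blast
  ultimately have "(\<Sum>n<m. hcomp n p) \<in> rel_ideal RB" "(\<Sum>n<m. hcomp n p) = p"
    using hcomp_expand by (auto intro: fa.subspace_sum[OF rel_ideal_subspace])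
  then show "p \<in> rel_ideal RB" by simp
qed (use hcomp_ideal_low in blast)

lemma T_basis:
  "inj_on (\<lambda>t. pres_class RT (M t)) Y"
  "vectorspace.basis ring_of_type_algebra (presented_alg RT) ((\<lambda>t. pres_class RT (M t)) ` Y)"
proof -
  have "\<exists>q\<in>fa.span (M ` Y). p - q \<in> rel_ideal RT" for p
  proof -
    obtain n where "p \<in> degless n" using ex_degless by blast
    from degless_expand[OF this] show ?thesis
      using fa.span_mono[of "M ` {t \<in> Y. deg t < n}" "M ` Y"] by blast
  qed
  then show "inj_on (\<lambda>t. pres_class RT (M t)) Y"
    "vectorspace.basis ring_of_type_algebra (presented_alg RT) ((\<lambda>t. pres_class RT (M t)) ` Y)"
    using basis_pres_class[OF fin] M_indep by blast+
qed

section \<open>The associated graded algebra of the deformation\<close>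

abbreviation "D \<equiv> presented_alg RT"
abbreviation "F \<equiv> word_filtration RT"

definition gcls :: "nat \<Rightarrow> ('g, 'k) free_algebra \<Rightarrow> ('g, 'k) free_algebra set set" where
  "gcls n p = filt_pred D F n +>\<^bsub>D\<^esub> pres_class RT p"

text \<open>Adding the preceding filtration piece to a class amounts to changing its representative
  by an element of \<open>low n\<close>.\<close>

lemma gcls_eq: "gcls n p = {pres_class RT x | x. x - p \<in> low n}"
proof (intro equalityI subsetI)
  fix v assume "v \<in> gcls n p"
  then obtain s where "s \<in> degless n" "v = pres_class RT (s + p)"
    by (auto simp: gcls_def a_r_coset_def' filt_pred_eq presented_alg_simps)
  then show "v \<in> {pres_class RT x | x. x - p \<in> low n}"
    using degless_low by (auto intro!: exI[of _ "s + p"])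
next
  fix v assume "v \<in> {pres_class RT x | x. x - p \<in> low n}"
  then obtain x s where x: "v = pres_class RT x" "s \<in> degless n" "x - p - s \<in> rel_ideal RT"
    by (auto simp: low_def)
  then have "v = pres_class RT s \<oplus>\<^bsub>D\<^esub> pres_class RT p"
    by (simp add: presented_alg_simps pres_class_eq_iff diff_diff_eq add.commute)
  with x(2) show "v \<in> gcls n p"
    by (auto simp: gcls_def a_r_coset_def' filt_pred_eq)
qed

lemma low_diff_swap: "x - p \<in> low n \<Longrightarrow> p - x \<in> low n"
  using fa.subspace_neg[OF low_subspace, of "x - p" n] by simp

lemma low_trans: "x - p \<in> low n \<Longrightarrow> p - q \<in> low n \<Longrightarrow> x - q \<in> low n"
  using fa.subspace_add[OF low_subspace, of "x - p" n "p - q"] by simp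

lemma gcls_self: "pres_class RT p \<in> gcls n p"
  using fa.subspace_0[OF low_subspace] by (auto simp: gcls_eq intro!: exI[of _ p])

lemma gcls_eq_iff: "gcls n p = gcls n q \<longleftrightarrow> p - q \<in> low n"
proof
  assume "gcls n p = gcls n q"
  then have "pres_class RT p \<in> gcls n q"
    using gcls_self[of p n] by simp
  then obtain x where "pres_class RT p = pres_class RT x" "x - q \<in> low n"
    unfolding gcls_eq by blast
  then show "p - q \<in> low n"
    using low_trans[of p x n q] rel_ideal_low by (simp add: pres_class_eq_iff)
next
  assume "p - q \<in> low n"
  then have "x - p \<in> low n \<longleftrightarrow> x - q \<in> low n" for x
    using low_trans low_diff_swap by blast
  then show "gcls n p = gcls n q" by (simp add: gcls_eq)
qed

lemma gcls_0: "gcls n 0 = filt_pred D F n"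
  by (auto simp: gcls_def a_r_coset_def' filt_pred_eq presented_alg_simps)

lemma gcls_add: "gcls n p <+>\<^bsub>D\<^esub> gcls n q = gcls n (p + q)"
proof (intro equalityI subsetI)
  fix v assume "v \<in> gcls n p <+>\<^bsub>D\<^esub> gcls n q"
  then obtain x y where "x - p \<in> low n" "y - q \<in> low n" "v = pres_class RT (x + y)"
    by (auto simp: set_add_def' gcls_eq presented_alg_simps)
  then show "v \<in> gcls n (p + q)"
    using fa.subspace_add[OF low_subspace, of "x - p" n "y - q"]
    by (auto simp: gcls_eq algebra_simps intro!: exI[of _ "x + y"])
next
  fix v assume "v \<in> gcls n (p + q)"
  then obtain z where z: "z - (p + q) \<in> low n" "v = pres_class RT z"
    by (auto simp: gcls_eq)
  have "v = pres_class RT (z - q) \<oplus>\<^bsub>D\<^esub> pres_class RT q"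
    by (simp add: z presented_alg_simps)
  moreover have "z - q - p \<in> low n"
    using z(1) by (simp add: diff_diff_eq add.commute)
  then have "pres_class RT (z - q) \<in> gcls n p"
    unfolding gcls_eq by blast
  moreover have "pres_class RT q \<in> gcls n q" by (rule gcls_self)
  ultimately show "v \<in> gcls n p <+>\<^bsub>D\<^esub> gcls n q"
    by (auto simp: set_add_def')
qed

text \<open>Since \<open>low n\<close> is a subspace, each member of the coset contributes the same
  set to the union, which is nonempty by \<open>gcls_self\<close>.\<close>

lemma gcls_smult: "(\<Union>v\<in>gcls n p. filt_pred D F n +>\<^bsub>D\<^esub> (c \<odot>\<^bsub>D\<^esub> v)) = gcls n (scal c * p)"
proof -
  have "filt_pred D F n +>\<^bsub>D\<^esub> (c \<odot>\<^bsub>D\<^esub> v) = gcls n (scal c * p)" if v: "v \<in> gcls n p" for v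
  proof -
    from v obtain x where x: "v = pres_class RT x" "x - p \<in> low n" by (auto simp: gcls_eq)
    then have "scal c * x - scal c * p \<in> low n"
      using fa.subspace_scale[OF low_subspace, of "x - p" n c] by (simp add: right_diff_distrib)
    then show ?thesis
      by (simp add: x(1) presented_alg_simps gcls_def[symmetric] gcls_eq_iff)
  qed
  moreover have "gcls n p \<noteq> {}" using gcls_self by blast
  ultimately show ?thesis by auto
qed

text \<open>The homomorphism from the free algebra onto the associated graded algebra that sends a
  word of length n to its class in degree n; its kernel is the ideal of \<open>RB\<close>.\<close>

definition symb :: "('g, 'k) free_algebra \<Rightarrow> nat \<Rightarrow> ('g, 'k) free_algebra set set" where
  "symb p = (\<lambda>n. gcls n (hcomp n p))"

lemma symb_eq_iff: "symb p = symb q \<longleftrightarrow> p - q \<in> rel_ideal RB"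
  by (simp add: symb_def fun_eq_iff gcls_eq_iff rel_ideal_iff_low hcomp_diff)

lemma symb_add: "symb p \<oplus>\<^bsub>gr_alg D F\<^esub> symb q = symb (p + q)"
  by (simp add: symb_def gr_alg_def gcls_add hcomp_add)

lemma symb_smult: "c \<odot>\<^bsub>gr_alg D F\<^esub> symb p = symb (scal c * p)"
  by (simp add: symb_def gr_alg_def gcls_smult hcomp_scal)

lemma symb_one: "symb 1 = \<one>\<^bsub>gr_alg D F\<^esub>"
  by (rule ext) (simp add: symb_def gr_alg_def hcomp_homog[OF one_homog] gcls_0 gcls_def[symmetric] presented_alg_simps)

text \<open>The product of \<open>gr_alg\<close> is a union over all families of representatives;
  each family yields the same coset, and at least one exists.\<close>

lemma symb_mult: "symb p \<otimes>\<^bsub>gr_alg D F\<^esub> symb q = symb (p * q)"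
proof (rule ext)
  fix n
  define U where "U = {filt_pred D F n +>\<^bsub>D\<^esub> (\<Oplus>\<^bsub>D\<^esub>i\<in>{..n}. u i \<otimes>\<^bsub>D\<^esub> v (n - i)) | u v.
      (\<forall>i. u i \<in> symb p i) \<and> (\<forall>i. v i \<in> symb q i)}"
  have "S = gcls n (hcomp n (p * q))" if "S \<in> U" for S
  proof -
    from that obtain u v where S: "S = filt_pred D F n +>\<^bsub>D\<^esub> (\<Oplus>\<^bsub>D\<^esub>i\<in>{..n}. u i \<otimes>\<^bsub>D\<^esub> v (n - i))"
      and "\<forall>i. u i \<in> symb p i" "\<forall>i. v i \<in> symb q i" by (auto simp: U_def)
    then have "\<forall>i. \<exists>x. u i = pres_class RT x \<and> x - hcomp i p \<in> low i"
      "\<forall>i. \<exists>x. v i = pres_class RT x \<and> x - hcomp i q \<in> low i"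
      by (auto simp: symb_def gcls_eq)
    then obtain x y where u: "\<And>i. u i = pres_class RT (x i)" and x: "\<And>i. x i - hcomp i p \<in> low i"
      and v: "\<And>i. v i = pres_class RT (y i)" and y: "\<And>i. y i - hcomp i q \<in> low i"
      by metis
    have "S = gcls n (\<Sum>i\<le>n. x i * y (n - i))"
      by (simp add: S u v presented_alg_simps(2) finsum_pres_class gcls_def)
    \<comment> \<open>The error splits as \<open>(x - h) * y + h * (y - h')\<close> with homogeneous
      components \<open>h\<close> and \<open>h'\<close>; in each term one factor drops in
      degree.\<close>
    moreover have "x i * y (n - i) - hcomp i p * hcomp (n - i) q \<in> low n" if "i \<le> n" for i
    proof -
      have "y (n - i) - hcomp (n - i) q \<in> low (Suc (n - i))"
        using y[of "n - i"] degless_mono[of "n - i" "Suc (n - i)"] by (auto simp: low_def)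
      from fa.subspace_add[OF low_subspace this homog_low[OF hcomp_in_homog[of "n - i" q]]]
      have "y (n - i) \<in> low (Suc (n - i))" by simp
      then have "(x i - hcomp i p) * y (n - i) \<in> low n"
        using low_mult[OF x[of i]] that by fastforce
      moreover have "hcomp i p * (y (n - i) - hcomp (n - i) q) \<in> low n"
        using low_mult'[OF homog_low[OF hcomp_in_homog[of i p]] y[of "n - i"]] that by simp
      ultimately show ?thesis
        using fa.subspace_add[OF low_subspace] by (fastforce simp: algebra_simps)
    qed
    then have "(\<Sum>i\<le>n. x i * y (n - i)) - hcomp n (p * q) \<in> low n"
      by (auto simp: hcomp_mult sum_subtractf[symmetric] intro!: fa.subspace_sum[OF low_subspace])
    ultimately show ?thesis by (simp add: gcls_eq_iff)
  qed
  moreover have "U \<noteq> {}"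
  proof -
    have "pres_class RT (hcomp i r) \<in> symb r i" for r i
      using fa.subspace_0[OF low_subspace] by (auto simp: symb_def gcls_eq intro!: exI[of _ "hcomp i r"])
    then have "filt_pred D F n +>\<^bsub>D\<^esub>
        (\<Oplus>\<^bsub>D\<^esub>i\<in>{..n}. pres_class RT (hcomp i p) \<otimes>\<^bsub>D\<^esub> pres_class RT (hcomp (n - i) q)) \<in> U"
      unfolding U_def
      by (intro CollectI exI[of _ "\<lambda>i. pres_class RT (hcomp i p)"] exI[of _ "\<lambda>i. pres_class RT (hcomp i q)"]) simp
    then show ?thesis by blast
  qed
  ultimately have "\<Union>U = gcls n (hcomp n (p * q))" by blast
  then show "(symb p \<otimes>\<^bsub>gr_alg D F\<^esub> symb q) n = symb (p * q) n"
    by (simp add: gr_alg_def symb_def U_def)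
qed

lemma carrier_gr: "carrier (gr_alg D F) = range symb"
proof (intro equalityI subsetI)
  fix f assume "f \<in> carrier (gr_alg D F)"
  then have f: "\<forall>n. f n \<in> {filt_pred D F n +>\<^bsub>D\<^esub> x | x. x \<in> F n}" "finite {n. f n \<noteq> filt_pred D F n}"
    by (auto simp: gr_alg_def)
  then have "\<forall>n. \<exists>x. f n = gcls n x \<and> x \<in> degless (Suc n)"
    unfolding word_filtration_eq[of RT] gcls_def by blast
  then obtain x where x: "\<And>n. f n = gcls n (x n)" "\<And>n. x n \<in> degless (Suc n)"
    by metis
  let ?Z = "{n. f n \<noteq> filt_pred D F n}"
  \<comment> \<open>Only top components matter: \<open>x n\<close> differs from its component of
    degree n by an element of \<open>degless n\<close>.\<close>
  define p where "p = (\<Sum>n\<in>?Z. hcomp n (x n))"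
  have p: "hcomp n p = (if n \<in> ?Z then hcomp n (x n) else 0)" for n
    using f(2) by (simp add: p_def hcomp_sum hcomp_hcomp)
  have "f n = symb p n" for n
  proof (cases "n \<in> ?Z")
    case True
    then show ?thesis
      using degless_low[OF degless_Suc_minus_hcomp[OF x(2)[of n]]] by (simp add: symb_def p x(1) gcls_eq_iff)
  next
    case False
    then show ?thesis by (simp add: symb_def p gcls_0)
  qed
  then show "f \<in> range symb" by blast
next
  fix f assume "f \<in> range symb"
  then obtain p where p: "f = symb p" by auto
  have "f n \<in> {filt_pred D F n +>\<^bsub>D\<^esub> x | x. x \<in> F n}" for n
    using hcomp_in_homog[of n p] homog_degless[of n]
    unfolding p symb_def gcls_def word_filtration_eq[of RT] by blast
  moreover obtain m where "p \<in> degless m" using ex_degless by blast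
  then have "{n. f n \<noteq> filt_pred D F n} \<subseteq> {..<m}"
    using hcomp_degless[of p m] by (auto simp: p symb_def gcls_0 not_less[symmetric])
  then have "finite {n. f n \<noteq> filt_pred D F n}" by (rule finite_subset) simp
  ultimately show "f \<in> carrier (gr_alg D F)" by (simp add: gr_alg_def)
qed

lemma gr_piece_eq: "gr_piece D F n = symb ` homog n"
proof (intro equalityI subsetI)
  fix f assume "f \<in> gr_piece D F n"
  then obtain p where p: "f = symb p" and z: "\<And>m. m \<noteq> n \<Longrightarrow> f m = filt_pred D F m"
    by (auto simp: gr_piece_def carrier_gr)
  have "f m = symb (hcomp n p) m" for m
    using z[of m] by (cases "m = n") (simp_all add: p symb_def hcomp_hcomp gcls_0)
  then have "f = symb (hcomp n p)" ..
  then show "f \<in> symb ` homog n" using hcomp_in_homog by blast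
next
  fix f assume "f \<in> symb ` homog n"
  then obtain p where p: "p \<in> homog n" "f = symb p" by blast
  then have "f m = filt_pred D F m" if "m \<noteq> n" for m
    using that by (simp add: symb_def hcomp_homog gcls_0)
  with p(2) show "f \<in> gr_piece D F n"
    by (simp add: gr_piece_def carrier_gr)
qed

lemma gr_iso: "graded_isomorphic ring_of_type_algebra (gr_alg D F) (gr_piece D F) (presented_alg RB) (word_grading RB)"
proof -
  \<comment> \<open>The fibres of the symbol map are the cosets of the ideal of \<open>RB\<close>.\<close>
  define \<phi> where "\<phi> = (\<lambda>f. {p. symb p = f})"
  have \<phi>: "\<phi> (symb p) = pres_class RB p" for p
    by (simp add: \<phi>_def pres_class_eq symb_eq_iff)
  have "\<phi> \<in> ring_hom (gr_alg D F) (presented_alg RB)"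
    by (rule ring_hom_memI)
      (auto simp: carrier_gr \<phi> presented_alg_simps symb_add symb_mult symb_one[symmetric])
  moreover have "bij_betw \<phi> (carrier (gr_alg D F)) (carrier (presented_alg RB))"
  proof -
    have "inj_on \<phi> (range symb)"
      by (auto simp: inj_on_def \<phi> pres_class_eq_iff symb_eq_iff)
    then show ?thesis
      by (simp add: bij_betw_def carrier_gr presented_alg_simps image_image \<phi>)
  qed
  moreover have "\<phi> \<in> module_hom ring_of_type_algebra (gr_alg D F) (presented_alg RB)"
    by (auto simp: module_hom_def carrier_gr \<phi> presented_alg_simps symb_add symb_smult)
  moreover have "\<phi> ` gr_piece D F n = word_grading RB n" for n
    by (simp add: gr_piece_eq word_grading_eq image_image \<phi>)
  ultimately show ?thesis
    unfolding graded_isomorphic_def ring_iso_def by blast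
qed

lemma pbw:
  "pbw_deformation ring_of_type_algebra (presented_alg RB) (word_grading RB) D F"
  unfolding pbw_deformation_def
  by (intro conjI word_grading_graded[OF RB_homog] word_filtration_filtered gr_iso)

end

section \<open>Spanning in the graded algebra\<close>

text \<open>Including the ideal in both spans allows congruent elements to be exchanged in
  membership proofs. \<open>S0\<close> covers the monomials without \<open>d\<close>, and
  \<open>y\<close> is taken with parameter 0.\<close>

locale spanning =
  fixes a b c d e y :: "(gen, 'k::field) free_algebra" and I S0 S :: "(gen, 'k) free_algebra set"
  defines "a \<equiv> gen_of Ga" and "b \<equiv> gen_of Gb" and "c \<equiv> gen_of Gc" and "d \<equiv> gen_of Gd"
    and "e \<equiv> b - a" and "y \<equiv> a * c + c * b + b * a"
    and "I \<equiv> rel_ideal B_rels"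
    and "S0 \<equiv> fa.span ({e^i * a^j * c^k * y^l | i j k l. i < 3 \<and> j < 2 \<and> k < 2 \<and> l < 3} \<union> I)"
    and "S \<equiv> fa.span ({e^i * a^j * c^k * y^l * d^m | i j k l m. i < 3 \<and> j < 2 \<and> k < 2 \<and> l < 3 \<and> m < 2} \<union> I)"
begin

lemma I_closed:
  "p \<in> I \<Longrightarrow> q \<in> I \<Longrightarrow> p + q \<in> I" "p \<in> I \<Longrightarrow> q \<in> I \<Longrightarrow> p - q \<in> I"
  "p \<in> I \<Longrightarrow> - p \<in> I" "p \<in> I \<Longrightarrow> r * p \<in> I" "p \<in> I \<Longrightarrow> p * r \<in> I"
  unfolding I_def
  by (fact rel_ideal_add rel_ideal_diff rel_ideal_uminus rel_ideal_mult_left rel_ideal_mult_right)+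

lemma rels:
  "a * a \<in> I" "b * b \<in> I" "c * c \<in> I" "d * d \<in> I"
  "a * b + b * c + c * a \<in> I" "a * c + c * d + d * a \<in> I"
  "a * d + b * a + d * b \<in> I" "b * d + c * b + d * c \<in> I" "(a + b + c)^6 \<in> I"
  unfolding I_def a_def b_def c_def d_def
  by (rule rel_ideal_base; simp add: B_rels_def Let_def power2_eq_square)+

text \<open>Each rewriting rule from here to \<open>eee\<close> is checked by writing the difference
  of its sides as an explicit combination of the relations.\<close>

lemma ae: "a * e - (- (e * e) - e * a) \<in> I"
proof -
  have "a * e - (- (e * e) - e * a) = b * b - a * a"
    by (simp add: e_def algebra_simps)
  then show ?thesis using rels by (simp add: I_closed)
qed

lemma ca: "c * a - (e * e + e * a - e * c - a * c) \<in> I"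
proof -
  have "c * a - (e * e + e * a - e * c - a * c) = (a * b + b * c + c * a) - b * b"
    by (simp add: e_def algebra_simps)
  then show ?thesis using I_closed(2)[OF rels(5) rels(2)] by (simp only:)
qed

lemma ce: "c * e - (y + e * c - e * a - e * a - e * e) \<in> I"
proof -
  have "c * e - (y + e * c - e * a - e * a - e * e) = b * b - a * a - (a * b + b * c + c * a)"
    by (simp add: e_def y_def algebra_simps)
  then show ?thesis using rels by (simp add: I_closed)
qed

text \<open>The cyclic substitution a -> b -> c -> a fixes \<open>y\<close> and \<open>?r\<close>;
  it carries this rule and its certificate to \<open>yb\<close> and then to
  \<open>yc\<close>.\<close>

lemma ya: "y * a - c * y \<in> I"
proof -
  let ?r = "a * b + b * c + c * a"
  have "y * a - c * y = a * ?r - ?r * c - (a * a) * b + b * (c * c) + b * (a * a) - (c * c) * b"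
    by (simp add: y_def algebra_simps)
  then show ?thesis using rels by (simp add: I_closed)
qed

lemma yb: "y * b - a * y \<in> I"
proof -
  let ?r = "a * b + b * c + c * a"
  have "y * b - a * y = b * ?r - ?r * a - (b * b) * c + c * (a * a) + c * (b * b) - (a * a) * c"
    by (simp add: y_def algebra_simps)
  then show ?thesis using rels by (simp add: I_closed)
qed

lemma yc: "y * c - b * y \<in> I"
proof -
  let ?r = "a * b + b * c + c * a"
  have "y * c - b * y = c * ?r - ?r * b - (c * c) * a + a * (b * b) + a * (c * c) - (b * b) * a"
    by (simp add: y_def algebra_simps)
  then show ?thesis using rels by (simp add: I_closed)
qed

lemma eee: "e * e * e \<in> I"
proof -
  let ?r = "a * b + b * c + c * a"
  have "e * e * e = ?r * a - b * ?r - c * (a * a) + (b * b) * c + (b * b) * b - (b * b) * a - (a * a) * a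
      + (a * a) * b + b * (a * a) - a * (b * b)"
    by (simp add: e_def algebra_simps)
  then show ?thesis using rels by (simp add: I_closed)
qed

text \<open>The square of \<open>a + b + c\<close> is congruent to \<open>y\<close>, so the relation
  of degree six becomes the vanishing of the cube of \<open>y\<close>.\<close>

lemma yyy: "y * y * y \<in> I"
proof -
  define s where "s = a + b + c"
  define z where "z = s * s - y"
  have "z = a * a + b * b + c * c + (a * b + b * c + c * a)"
    by (simp add: z_def s_def y_def algebra_simps)
  then have z: "z \<in> I" using rels by (simp add: I_closed)
  have "s^6 = s * s * (s * s) * (s * s)"
    by (simp add: numeral_eq_Suc mult.assoc)
  \<comment> \<open>A telescoping sum that replaces one factor \<open>s * s\<close> by
    \<open>y\<close> at a time.\<close>
  then have "y * y * y = s^6 - z * (s * s) * (s * s) - y * z * (s * s) - y * y * z"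
    by (simp add: z_def algebra_simps)
  then show ?thesis using rels z by (simp add: I_closed s_def)
qed

section \<open>Stability of the span of the monomials without d\<close>

lemma S0_subspace: "fa.subspace S0"
  unfolding S0_def by (rule fa.subspace_span)

lemma S0_closed: "p \<in> S0 \<Longrightarrow> q \<in> S0 \<Longrightarrow> p + q \<in> S0" "p \<in> S0 \<Longrightarrow> q \<in> S0 \<Longrightarrow> p - q \<in> S0"
  "p \<in> S0 \<Longrightarrow> - p \<in> S0"
  unfolding S0_def by (fact fa.span_add fa.span_diff fa.span_neg)+

lemma I_S0: "p \<in> I \<Longrightarrow> p \<in> S0"
  unfolding S0_def by (simp add: fa.span_base)

lemma base_S0: "i < 3 \<Longrightarrow> j < 2 \<Longrightarrow> k < 2 \<Longrightarrow> l < 3 \<Longrightarrow> e^i * a^j * c^k * y^l \<in> S0"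
  unfolding S0_def by (rule fa.span_base) blast

lemma cong_S0: "p - q \<in> I \<Longrightarrow> q \<in> S0 \<Longrightarrow> p \<in> S0"
  using S0_closed(1)[OF I_S0, of "p - q" q] by simp

text \<open>Left multiplication is linear and preserves the ideal, so stability is decided on the
  monomials.\<close>

lemma left_S0:
  assumes "\<And>i j k l. i < 3 \<Longrightarrow> j < 2 \<Longrightarrow> k < 2 \<Longrightarrow> l < 3 \<Longrightarrow> x * (e^i * a^j * c^k * y^l) \<in> S0"
    and "p \<in> S0"
  shows "x * p \<in> S0"
proof -
  have "fa.subspace {p. x * p \<in> S0}"
    using fa.subspace_0[OF S0_subspace] fa.subspace_scale[OF S0_subspace] S0_closed
    by (auto simp: fa.subspace_def distrib_left scal_left_commute)
  moreover have "{e^i * a^j * c^k * y^l | i j k l. i < 3 \<and> j < 2 \<and> k < 2 \<and> l < 3} \<union> I \<subseteq> {p. x * p \<in> S0}"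
    using assms(1) by (auto intro: I_S0 I_closed)
  ultimately show ?thesis
    using fa.span_minimal assms(2) unfolding S0_def by blast
qed

text \<open>An exponent out of range produces a factor \<open>e^3\<close>, \<open>a^2\<close>,
  \<open>c^2\<close> or \<open>y^3\<close>, so such a monomial lies in the ideal. Later lemmas can
  then raise exponents freely.\<close>

lemma base_S0': "e^i * a^j * c^k * y^l \<in> S0"
proof -
  have *: "u * x ^ n * v \<in> I" if "x ^ m \<in> I" "m \<le> n" for u v x :: "(gen, 'k) free_algebra" and m n
  proof -
    have "x ^ n = x ^ m * x ^ (n - m)" using that(2) by (simp add: power_add[symmetric])
    then show ?thesis using that(1) by (simp add: I_closed)
  qed
  have "e^i * a^j * c^k * y^l \<in> I" if "3 \<le> i \<or> 2 \<le> j \<or> 2 \<le> k \<or> 3 \<le> l"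
    using *[of e 3 i 1 "a^j * c^k * y^l"] *[of a 2 j "e^i" "c^k * y^l"]
      *[of c 2 k "e^i * a^j" "y^l"] *[of y 3 l "e^i * a^j * c^k" 1] rels eee yyy that
    by (auto simp: mult.assoc power2_eq_square power3_eq_cube)
  then show ?thesis
    using base_S0[of i j k l] I_S0 by fastforce
qed

lemma e_S0: "p \<in> S0 \<Longrightarrow> e * p \<in> S0"
proof (rule left_S0)
  show "e * (e^i * a^j * c^k * y^l) \<in> S0" for i j k l
    using base_S0'[of "Suc i" j k l] by (simp add: mult.assoc)
qed

text \<open>Induction on the exponent of \<open>e\<close>: rule \<open>ae\<close> moves
  \<open>a\<close> past one \<open>e\<close> at a time.\<close>

lemma a_S0: "p \<in> S0 \<Longrightarrow> a * p \<in> S0"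
proof (rule left_S0)
  fix i j k l :: nat assume "i < 3"
  show "a * (e^i * a^j * c^k * y^l) \<in> S0"
    using \<open>i < 3\<close>
  proof (induction i)
    case 0
    show ?case using base_S0'[of 0 "Suc j" k l] by (simp add: mult.assoc)
  next
    case (Suc i)
    define w where "w = e^i * a^j * c^k * y^l"
    have "(a * e - (- (e * e) - e * a)) * w \<in> I" using ae by (rule I_closed)
    then have "a * (e * w) - (- (e * (e * w)) - e * (a * w)) \<in> I"
      by (simp add: algebra_simps)
    moreover have "w \<in> S0" "a * w \<in> S0"
      using Suc base_S0' by (simp_all add: w_def)
    ultimately have "a * (e * w) \<in> S0"
      by (elim cong_S0) (intro S0_closed e_S0)
    then show ?case by (simp add: w_def mult.assoc)
  qed
qed

lemma c_mult: "c * (a * w) - (e * (e * w) + e * (a * w) - e * (c * w) - a * (c * w)) \<in> I"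
  "c * (e * w) - (y * w + e * (c * w) - e * (a * w) - e * (a * w) - e * (e * w)) \<in> I"
  using I_closed(5)[OF ca, of w] I_closed(5)[OF ce, of w] by (simp_all add: algebra_simps)

lemma ca_S0: "w \<in> S0 \<Longrightarrow> c * w \<in> S0 \<Longrightarrow> c * (a * w) \<in> S0"
  by (rule cong_S0[OF c_mult(1)]) (intro S0_closed e_S0 a_S0)

text \<open>Passing \<open>c\<close> over \<open>e\<close> creates \<open>y\<close>, so the action
  of \<open>c\<close> depends on that of \<open>y\<close> on the remaining monomial.\<close>

lemma ce_S0: "w \<in> S0 \<Longrightarrow> c * w \<in> S0 \<Longrightarrow> y * w \<in> S0 \<Longrightarrow> c * (e * w) \<in> S0"
  by (rule cong_S0[OF c_mult(2)]) (intro S0_closed e_S0 a_S0)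

lemma c_base: "j < 2 \<Longrightarrow> c * (a^j * c^k * y^l) \<in> S0"
  using base_S0'[of 0 0 "Suc k" l] base_S0'[of 0 0 k l] ca_S0[of "c^k * y^l"]
  by (auto simp: less_2_cases_iff mult.assoc)

lemma y_left: "y * (a * w) - c * (y * w) \<in> I" "y * (c * w) - b * (y * w) \<in> I"
  "y * (e * w) - (a * (y * w) - c * (y * w)) \<in> I"
proof -
  have "y * e - (a * y - c * y) = (y * b - a * y) - (y * a - c * y)"
    by (simp add: e_def algebra_simps)
  then have "y * e - (a * y - c * y) \<in> I" using I_closed(2)[OF yb ya] by (simp only:)
  from I_closed(5)[OF ya, of w] I_closed(5)[OF yc, of w] I_closed(5)[OF this, of w]
  show "y * (a * w) - c * (y * w) \<in> I" "y * (c * w) - b * (y * w) \<in> I"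
    "y * (e * w) - (a * (y * w) - c * (y * w)) \<in> I"
    by (simp_all add: algebra_simps)
qed

lemma b_S0: "p \<in> S0 \<Longrightarrow> b * p \<in> S0"
  using S0_closed(1)[OF e_S0 a_S0, of p p] by (simp add: e_def left_diff_distrib)

lemma c_y_power: "c * y^l \<in> S0" "c * (b * y^l) \<in> S0" "y^l \<in> S0"
proof -
  show y: "y^l \<in> S0" for l using base_S0'[of 0 0 0 l] by simp
  show c: "c * y^l \<in> S0" using base_S0'[of 0 0 1 l] by simp
  have "c * (e * y^l) \<in> S0" using ce_S0[OF y c] y[of "Suc l"] by simp
  moreover have "c * (a * y^l) \<in> S0" using ca_S0[OF y c] .
  ultimately have "c * (e * y^l) + c * (a * y^l) \<in> S0" by (rule S0_closed)
  then show "c * (b * y^l) \<in> S0" by (simp add: e_def algebra_simps)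
qed

text \<open>Moving \<open>y\<close> to the right turns \<open>a\<close> into \<open>c\<close> and
  \<open>c\<close> into \<open>b\<close>, which leads to \<open>u = b^k * y^(l+1)\<close> and
  \<open>v = c^j * u\<close>. The second claim serves monomials with two factors \<open>e\<close> in
  \<open>c_S0\<close>.\<close>

lemma y_base:
  assumes "j < 2" "k < 2"
  shows "y * (a^j * c^k * y^l) \<in> S0" "c * (y * (a^j * c^k * y^l)) \<in> S0"
proof -
  define u where "u = (if k = 0 then 1 else b) * y^Suc l"
  have u: "u \<in> S0" "c * u \<in> S0"
    using c_y_power[of "Suc l"] b_S0[of "y^Suc l"] by (auto simp: u_def)
  have k: "y * (c^k * y^l) - u \<in> I"
    using assms(2) y_left(2)[of "y^l"] rel_ideal_zero[of B_rels]
    by (auto simp: u_def less_2_cases_iff I_def)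
  define v where "v = (if j = 0 then 1 else c) * u"
  have j: "y * (a^j * c^k * y^l) - v \<in> I"
  proof (cases "j = 0")
    case False
    with assms have "j = 1" by simp
    moreover have "c * (y * (c^k * y^l) - u) \<in> I" using k by (rule I_closed)
    from I_closed(1)[OF y_left(1)[of "c^k * y^l"] this]
    have "y * (a * (c^k * y^l)) - c * u \<in> I" by (simp add: right_diff_distrib)
    ultimately show ?thesis by (simp add: v_def mult.assoc)
  qed (use k in \<open>simp add: v_def\<close>)
  have v: "v \<in> S0" "c * v \<in> S0"
    using u I_S0[OF I_closed(5)[OF rels(3), of u]] by (auto simp: v_def mult.assoc)
  show "y * (a^j * c^k * y^l) \<in> S0" by (rule cong_S0[OF j v(1)])
  have "c * (y * (a^j * c^k * y^l)) - c * v \<in> I"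
    using I_closed(4)[OF j, of c] by (simp add: right_diff_distrib)
  then show "c * (y * (a^j * c^k * y^l)) \<in> S0" using v(2) by (rule cong_S0)
qed

text \<open>At most two factors \<open>e\<close> have to be passed by \<open>ce_S0\<close>. The
  second passage needs \<open>y * (e * w)\<close>, which \<open>y_left\<close> reduces to
  \<open>a\<close> and \<open>c\<close> applied to \<open>y * w\<close>.\<close>

lemma c_S0: "p \<in> S0 \<Longrightarrow> c * p \<in> S0"
proof (rule left_S0)
  fix i j k l :: nat assume ij: "i < 3" "j < 2" "k < 2"
  define w where "w = a^j * c^k * y^l"
  have w: "w \<in> S0" "c * w \<in> S0" "y * w \<in> S0" "c * (y * w) \<in> S0"
    using base_S0'[of 0 j k l] c_base[of j k l] y_base[of j k l] ij by (simp_all add: w_def)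
  have "a * (y * w) - c * (y * w) \<in> S0" using w by (intro S0_closed a_S0)
  then have "y * (e * w) \<in> S0" by (rule cong_S0[OF y_left(3)])
  then have "c * (e * w) \<in> S0" "c * (e * (e * w)) \<in> S0"
    using w e_S0[OF w(1)] ce_S0[of w] ce_S0[of "e * w"] by auto
  with w ij(1) have "c * (e^i * w) \<in> S0"
    by (auto simp: less_Suc_eq numeral_3_eq_3 mult.assoc)
  then show "c * (e^i * a^j * c^k * y^l) \<in> S0" by (simp add: w_def mult.assoc)
qed

section \<open>Adding the factor d on the right\<close>

lemma S_closed: "p \<in> S \<Longrightarrow> q \<in> S \<Longrightarrow> p + q \<in> S" "p \<in> S \<Longrightarrow> q \<in> S \<Longrightarrow> p - q \<in> S"
  "p \<in> S \<Longrightarrow> - p \<in> S"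
  unfolding S_def by (fact fa.span_add fa.span_diff fa.span_neg)+

lemma S_subspace: "fa.subspace S"
  unfolding S_def by (rule fa.subspace_span)

lemma I_S: "p \<in> I \<Longrightarrow> p \<in> S"
  unfolding S_def by (simp add: fa.span_base)

lemma base_S: "i < 3 \<Longrightarrow> j < 2 \<Longrightarrow> k < 2 \<Longrightarrow> l < 3 \<Longrightarrow> m < 2 \<Longrightarrow> e^i * a^j * c^k * y^l * d^m \<in> S"
  unfolding S_def by (rule fa.span_base) blast

lemma S0_S: "p \<in> S0 \<Longrightarrow> m < 2 \<Longrightarrow> p * d^m \<in> S"
proof -
  assume p: "p \<in> S0" and m: "m < 2"
  have "fa.subspace {p. p * d^m \<in> S}"
    using fa.subspace_0[OF S_subspace] fa.subspace_scale[OF S_subspace] S_closed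
    by (auto simp: fa.subspace_def distrib_right mult.assoc)
  moreover have "{e^i * a^j * c^k * y^l | i j k l. i < 3 \<and> j < 2 \<and> k < 2 \<and> l < 3} \<union> I \<subseteq> {p. p * d^m \<in> S}"
    using m by (auto intro: base_S I_S I_closed)
  ultimately show ?thesis
    using fa.span_minimal p unfolding S0_def by blast
qed

lemma left_S:
  assumes "\<And>p m. p \<in> S0 \<Longrightarrow> m < 2 \<Longrightarrow> x * (p * d^m) \<in> S" and "p \<in> S"
  shows "x * p \<in> S"
proof -
  have "fa.subspace {p. x * p \<in> S}"
    using fa.subspace_0[OF S_subspace] fa.subspace_scale[OF S_subspace] S_closed
    by (auto simp: fa.subspace_def distrib_left scal_left_commute)
  moreover have "{e^i * a^j * c^k * y^l * d^m | i j k l m. i < 3 \<and> j < 2 \<and> k < 2 \<and> l < 3 \<and> m < 2} \<union> I \<subseteq> {p. x * p \<in> S}"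
    using assms(1)[OF base_S0'] by (auto intro: I_S I_closed)
  ultimately show ?thesis
    using fa.span_minimal assms(2) unfolding S_def by blast
qed

lemma abc_S: "p \<in> S \<Longrightarrow> a * p \<in> S" "p \<in> S \<Longrightarrow> b * p \<in> S" "p \<in> S \<Longrightarrow> c * p \<in> S"
  using left_S[of a p] left_S[of b p] left_S[of c p] a_S0 b_S0 c_S0 S0_S
  by (simp_all add: mult.assoc[symmetric])

lemma right_d_S:
  assumes "p \<in> S" shows "p * d \<in> S"
proof -
  have "fa.subspace {p. p * d \<in> S}"
    using fa.subspace_0[OF S_subspace] fa.subspace_scale[OF S_subspace] S_closed
    by (auto simp: fa.subspace_def distrib_right mult.assoc)
  moreover have "e^i * a^j * c^k * y^l * d^m * d \<in> S" if "m < 2" for i j k l m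
  proof (cases "m = 0")
    case True
    then show ?thesis using S0_S[OF base_S0', of 1 i j k l] by simp
  next
    case False
    with that have "m = 1" by simp
    then show ?thesis using I_S[OF I_closed(4)[OF rels(4), of "e^i * a^j * c^k * y^l"]] by (simp add: mult.assoc)
  qed
  then have "{e^i * a^j * c^k * y^l * d^m | i j k l m. i < 3 \<and> j < 2 \<and> k < 2 \<and> l < 3 \<and> m < 2} \<union> I \<subseteq> {p. p * d \<in> S}"
    by (auto intro: I_S I_closed)
  ultimately show ?thesis
    using fa.span_minimal assms unfolding S_def by blast
qed

lemma cong_S: "p - q \<in> I \<Longrightarrow> q \<in> S \<Longrightarrow> p \<in> S"
  using S_closed(1)[OF I_S, of "p - q" q] by simp

text \<open>The relations containing \<open>d\<close> rewrite \<open>d * a\<close>,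
  \<open>d * b\<close> and \<open>d * c\<close> into terms where \<open>d\<close> is absent or
  stands directly before \<open>p\<close>.\<close>

lemma d_abc_S:
  assumes "p \<in> S" "d * p \<in> S"
  shows "d * (a * p) \<in> S" "d * (b * p) \<in> S" "d * (c * p) \<in> S"
proof -
  have "d * (a * p) - (- (a * (c * p)) - c * (d * p)) = (a * c + c * d + d * a) * p"
    "d * (b * p) - (- (b * (a * p)) - a * (d * p)) = (a * d + b * a + d * b) * p"
    "d * (c * p) - (- (c * (b * p)) - b * (d * p)) = (b * d + c * b + d * c) * p"
    by (simp_all add: algebra_simps)
  then have I: "d * (a * p) - (- (a * (c * p)) - c * (d * p)) \<in> I"
    "d * (b * p) - (- (b * (a * p)) - a * (d * p)) \<in> I"
    "d * (c * p) - (- (c * (b * p)) - b * (d * p)) \<in> I"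
    using rels by (simp_all add: I_closed)
  show "d * (a * p) \<in> S" by (rule cong_S[OF I(1)]) (intro S_closed abc_S assms)
  show "d * (b * p) \<in> S" by (rule cong_S[OF I(2)]) (intro S_closed abc_S assms)
  show "d * (c * p) \<in> S" by (rule cong_S[OF I(3)]) (intro S_closed abc_S assms)
qed

lemma d_base: "d * (e^i * a^j * c^k * y^l) \<in> S"
proof -
  \<comment> \<open>\<open>Q\<close> is stable under left multiplication by \<open>a\<close>,
    \<open>b\<close>, \<open>c\<close>, hence by \<open>e\<close> and \<open>y\<close>; the monomial
    is built up from 1 inside it.\<close>
  define Q where "Q = {p \<in> S. d * p \<in> S}"
  have abc: "a * p \<in> Q" "b * p \<in> Q" "c * p \<in> Q" if "p \<in> Q" for p
    using that abc_S d_abc_S by (auto simp: Q_def)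
  have e: "e * p \<in> Q" if "p \<in> Q" for p
    using abc[OF that] S_closed by (simp add: Q_def e_def algebra_simps)
  have y: "y * p \<in> Q" if "p \<in> Q" for p
    using abc(1)[OF abc(3)[OF that]] abc(3)[OF abc(2)[OF that]] abc(2)[OF abc(1)[OF that]] S_closed
    by (simp add: Q_def y_def distrib_left distrib_right mult.assoc)
  have "1 \<in> Q"
    using S0_S[OF base_S0'[of 0 0 0 0], of 0] S0_S[OF base_S0'[of 0 0 0 0], of 1] by (simp add: Q_def)
  then have "y^l \<in> Q" by (induction l) (simp_all add: y)
  then have "c^k * y^l \<in> Q" by (induction k) (simp_all add: abc mult.assoc)
  then have "a^j * (c^k * y^l) \<in> Q" by (induction j) (simp_all add: abc mult.assoc)
  then have "e^i * (a^j * (c^k * y^l)) \<in> Q" by (induction i) (simp_all add: e mult.assoc)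
  then show ?thesis by (simp add: Q_def mult.assoc)
qed

lemma d_S: "p \<in> S \<Longrightarrow> d * p \<in> S"
proof (rule left_S)
  fix p m assume p: "p \<in> S0" and m: "m < (2::nat)"
  have "fa.subspace {p. d * p \<in> S}"
    using fa.subspace_0[OF S_subspace] fa.subspace_scale[OF S_subspace] S_closed
    by (auto simp: fa.subspace_def distrib_left scal_left_commute)
  moreover have "{e^i * a^j * c^k * y^l | i j k l. i < 3 \<and> j < 2 \<and> k < 2 \<and> l < 3} \<union> I \<subseteq> {p. d * p \<in> S}"
    using d_base by (auto intro: I_S I_closed)
  ultimately have "d * p \<in> S"
    using fa.span_minimal p unfolding S0_def by blast
  with m show "d * (p * d^m) \<in> S"
    using right_d_S[of "d * p"] by (auto simp: less_2_cases_iff mult.assoc)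
qed

lemma S_UNIV: "p \<in> S"
proof (rule free_algebra_subspace_UNIV[OF S_subspace])
  show "1 \<in> S" using S0_S[OF base_S0'[of 0 0 0 0], of 0] by simp
  show "gen_of x * p \<in> S" if "p \<in> S" for x p
    using that abc_S[of p] d_S[of p] by (cases x) (simp_all add: a_def b_def c_def d_def)
qed

end

section \<open>A representation of rank 12\<close>

text \<open>One explicit coordinate for each \<open>(b - a)^i * a^j * c^k\<close> with i < 3 and j,
  k < 2, so that an operator identity splits into polynomial identities checked by
  expansion.\<close>

datatype 'a vec12 = V 'a 'a 'a 'a 'a 'a 'a 'a 'a 'a 'a 'a

instantiation vec12 :: (ab_group_add) ab_group_add
begin

definition zero_vec12 :: "'a vec12" where
  "zero_vec12 = V 0 0 0 0 0 0 0 0 0 0 0 0"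

fun plus_vec12 :: "'a vec12 \<Rightarrow> 'a vec12 \<Rightarrow> 'a vec12" where
  "plus_vec12 (V v0 v1 v2 v3 v4 v5 v6 v7 v8 v9 v10 v11) (V w0 w1 w2 w3 w4 w5 w6 w7 w8 w9 w10 w11) = V (v0 + w0) (v1 + w1) (v2 + w2) (v3 + w3) (v4 + w4) (v5 + w5) (v6 + w6) (v7 + w7) (v8 + w8) (v9 + w9) (v10 + w10) (v11 + w11)"

fun uminus_vec12 :: "'a vec12 \<Rightarrow> 'a vec12" where
  "uminus_vec12 (V v0 v1 v2 v3 v4 v5 v6 v7 v8 v9 v10 v11) = V (- v0) (- v1) (- v2) (- v3) (- v4) (- v5) (- v6) (- v7) (- v8) (- v9) (- v10) (- v11)"

definition minus_vec12 :: "'a vec12 \<Rightarrow> 'a vec12 \<Rightarrow> 'a vec12" where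
  "minus_vec12 v w = v + - w"

instance
proof
  fix u v w :: "'a vec12"
  show "u + v + w = u + (v + w)" by (cases u; cases v; cases w) (simp add: add.assoc)
  show "u + v = v + u" by (cases u; cases v) (simp add: add.commute)
  show "0 + u = u" by (cases u) (simp add: zero_vec12_def)
  show "- u + u = 0" by (cases u) (simp add: zero_vec12_def)
  show "u - v = u + - v" by (rule minus_vec12_def)
qed

end

primrec vscale :: "'a::comm_ring_1 \<Rightarrow> 'a vec12 \<Rightarrow> 'a vec12" where
  "vscale s (V v0 v1 v2 v3 v4 v5 v6 v7 v8 v9 v10 v11) = V (s * v0) (s * v1) (s * v2) (s * v3) (s * v4) (s * v5) (s * v6) (s * v7) (s * v8) (s * v9) (s * v10) (s * v11)"

lemma vscale_simps:
  "vscale s (v + w) = vscale s v + vscale s w"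
  "vscale (s + t) v = vscale s v + vscale t v"
  "vscale s (vscale t v) = vscale (s * t) v"
  "vscale 1 v = v"
  "vscale s 0 = 0"
  by (cases v; cases w; simp add: algebra_simps zero_vec12_def)+

text \<open>
  The left multiplications by \<open>a\<close>, \<open>b\<close>, \<open>c\<close>, \<open>d\<close> and \<open>y\<close> on the right module over the commutative ring
  generated by \<open>d\<close> and \<open>y\<close> with basis \<open>(b - a)\<^sup>i a\<^sup>j c\<^sup>k\<close> in lexicographic order, for
  \<open>\<alpha>\<^sub>1 = d\<^sup>2\<close> and \<open>\<alpha>\<^sub>2 = h\<close>. The entries come from the rewriting rules
  \<open>a (b - a) = - (b - a)\<^sup>2 - (b - a) a\<close>, \<open>c (b - a) = y - 2 (b - a) a - (b - a)\<^sup>2 + (b - a) c\<close>,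
  \<open>(b - a)\<^sup>3 = (3 \<alpha>\<^sub>1 - \<alpha>\<^sub>2) (b - a)\<close>, \<open>y a = c y\<close>, \<open>y b = a y\<close>, \<open>y c = b y\<close>, \<open>d y = y d\<close> and the
  defining relations.
\<close>

primrec opA :: "'a \<Rightarrow> 'a::comm_ring_1 vec12 \<Rightarrow> 'a vec12" where
  "opA d (V v0 v1 v2 v3 v4 v5 v6 v7 v8 v9 v10 v11) = V
      ((d ^ 2) * v2)
      ((d ^ 2) * v3)
      (v0)
      (v1)
      (- (d ^ 2) * v6)
      (- (d ^ 2) * v7)
      (- v4)
      (- v5)
      (- v4 + (d ^ 2) * v10)
      (- v5 + (d ^ 2) * v11)
      (- v6 + v8)
      (- v7 + v9)"

primrec opB :: "'a \<Rightarrow> 'a \<Rightarrow> 'a::comm_ring_1 vec12 \<Rightarrow> 'a vec12" where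
  "opB d h (V v0 v1 v2 v3 v4 v5 v6 v7 v8 v9 v10 v11) = V
      ((d ^ 2) * v2)
      ((d ^ 2) * v3)
      (v0)
      (v1)
      (v0 - (d ^ 2) * v6 - h * v8 + 3 * (d ^ 2) * v8)
      (v1 - (d ^ 2) * v7 - h * v9 + 3 * (d ^ 2) * v9)
      (v2 - v4 - h * v10 + 3 * (d ^ 2) * v10)
      (v3 - v5 - h * v11 + 3 * (d ^ 2) * v11)
      ((d ^ 2) * v10)
      ((d ^ 2) * v11)
      (v8)
      (v9)"

primrec opC :: "'a \<Rightarrow> 'a \<Rightarrow> 'a \<Rightarrow> 'a::comm_ring_1 vec12 \<Rightarrow> 'a vec12" where
  "opC d h y (V v0 v1 v2 v3 v4 v5 v6 v7 v8 v9 v10 v11) = V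
      ((d ^ 2) * v1 + h * v2 - (d ^ 2) * v2 + y * v4 + (y ^ 2) * v7 + h * y * v7 - (d ^ 2) * y * v7 - (y ^ 2) * v9 - h * y * v9 + 2 * (d ^ 2) * y * v9 - (d ^ 2) * y * v10)
      (v0 + h * v3 - (d ^ 2) * v3 + y * v6 - y * v8 - (d ^ 2) * y * v11)
      (- (d ^ 2) * v3 + y * v5 + y * v8 + (y ^ 2) * v11 + h * y * v11 - 2 * (d ^ 2) * y * v11)
      (- v2 - y * v7 + y * v9 + y * v10)
      (- (d ^ 2) * v3 + y * v5 + (d ^ 2) * v5 + y * v8 + (y ^ 2) * v11 + h * y * v11 - (d ^ 2) * y * v11 + (d ^ 2) * h * v11 - 3 * (d ^ 4) * v11)
      (- v2 + v4 + y * v10 + h * v10 - 3 * (d ^ 2) * v10)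
      (v2 - 2 * v4 - y * v7 - (d ^ 2) * v7 + y * v9 - h * v10 + 3 * (d ^ 2) * v10)
      (v3 - 2 * v5 - v6 - y * v11 - h * v11 + 3 * (d ^ 2) * v11)
      (v2 - v4 - (d ^ 2) * v7 + (d ^ 2) * v9 + 2 * (d ^ 2) * v10)
      (v3 - v5 - v6 + v8 + 2 * (d ^ 2) * v11)
      (- (d ^ 2) * v11)
      (- v10)"

primrec opD :: "'a \<Rightarrow> 'a \<Rightarrow> 'a \<Rightarrow> 'a::comm_ring_1 vec12 \<Rightarrow> 'a vec12" where
  "opD d h y (V v0 v1 v2 v3 v4 v5 v6 v7 v8 v9 v10 v11) = V
      (d * v0 - y * v1 + (d ^ 2) * v1 + h * v2 + d * y * v3 + d * h * v3 - (d ^ 3) * v3 - (d ^ 2) * v4 - d * y * v5 - d * h * v5 + 2 * (d ^ 3) * v5 - (d ^ 3) * v6 + (d ^ 2) * y * v7 - (d ^ 4) * v7 - d * h * v8 + 3 * (d ^ 3) * v8 - (y ^ 2) * v9 - (d ^ 2) * y * v9 - (d ^ 2) * y * v10 - (d ^ 2) * h * v10 + 3 * (d ^ 4) * v10 - d * h * y * v11 - d * (h ^ 2) * v11 + 3 * (d ^ 3) * y * v11 + 4 * (d ^ 3) * h * v11 - 3 * (d ^ 5) * v11)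
      (- d * v2 + d * v4 + h * v5 - 2 * (d ^ 2) * v5 + (d ^ 2) * v6 + (d ^ 3) * v7 - y * v8 + h * v8 - 3 * (d ^ 2) * v8 + d * h * v10 - 3 * (d ^ 3) * v10 + (h ^ 2) * v11 - (d ^ 2) * y * v11 - 4 * (d ^ 2) * h * v11 + 3 * (d ^ 4) * v11)
      (- d * v1 - d * v4 + y * v5 - (d ^ 2) * v5 - (d ^ 2) * v6 - d * y * v7 - d * h * v7 + 2 * (d ^ 3) * v7 + y * v8 + d * h * v9 - 3 * (d ^ 3) * v9 + (y ^ 2) * v11 + h * y * v11 - 2 * (d ^ 2) * y * v11 - (d ^ 2) * h * v11 + 3 * (d ^ 4) * v11)
      (v1 - v2 - d * v3 + v4 + d * v5 + d * v6 + h * v7 - 2 * (d ^ 2) * v7 + y * v9 - h * v9 + 3 * (d ^ 2) * v9 + y * v10 + d * h * v11 - 3 * (d ^ 3) * v11)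
      (- d * v1 + (d ^ 2) * v3 - (d ^ 2) * v6 - h * v8 + 2 * (d ^ 2) * v8 - d * y * v9 - (d ^ 3) * v9 - (d ^ 3) * v10 + (d ^ 2) * y * v11 - (d ^ 2) * h * v11 + 2 * (d ^ 4) * v11)
      (- (d ^ 2) * v7 + d * v8 + (d ^ 2) * v9 + (d ^ 2) * v10 + (d ^ 3) * v11)
      (v1 - d * v3 - v4 - d * v8 + y * v9 - h * v9 + 2 * (d ^ 2) * v9 - h * v10 + 2 * (d ^ 2) * v10 - d * y * v11 - (d ^ 3) * v11)
      (- v5 + v8 + d * v9 + d * v10 + (d ^ 2) * v11)
      (- d * v5 + (d ^ 2) * v7 - d * v8 - d * y * v11 - d * h * v11 + (d ^ 3) * v11)
      (v8 + d * v10 + h * v11)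
      (v5 - d * v7 + v8 + d * v9 + y * v11 - (d ^ 2) * v11)
      (d * v11)"

primrec opY :: "'a \<Rightarrow> 'a \<Rightarrow> 'a \<Rightarrow> 'a::comm_ring_1 vec12 \<Rightarrow> 'a vec12" where
  "opY d h y (V v0 v1 v2 v3 v4 v5 v6 v7 v8 v9 v10 v11) = V
      (y * v0 + (y ^ 2) * v3 + h * y * v3 - (d ^ 2) * y * v3 - (y ^ 2) * v5 - h * y * v5 + 2 * (d ^ 2) * y * v5 - (d ^ 2) * y * v6 - h * y * v8 + 3 * (d ^ 2) * y * v8 - h * (y ^ 2) * v11 - (h ^ 2) * y * v11 + 3 * (d ^ 2) * (y ^ 2) * v11 + 4 * (d ^ 2) * h * y * v11 - 3 * (d ^ 4) * y * v11)
      (y * v2 - y * v4 - (d ^ 2) * y * v7 - h * y * v10 + 3 * (d ^ 2) * y * v10)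
      (y * v1 + y * v4 + (y ^ 2) * v7 + h * y * v7 - 2 * (d ^ 2) * y * v7 - h * y * v9 + 3 * (d ^ 2) * y * v9)
      (- y * v3 + y * v5 + y * v6 + h * y * v11 - 3 * (d ^ 2) * y * v11)
      (y * v1 + (y ^ 2) * v9 + (d ^ 2) * y * v9 + (d ^ 2) * y * v10)
      (y * v8 + (d ^ 2) * y * v11)
      (- y * v3 - y * v8 - (y ^ 2) * v11 - (d ^ 2) * y * v11)
      (- y * v9 - y * v10)
      (- y * v5 - y * v8 - (y ^ 2) * v11 - h * y * v11 + (d ^ 2) * y * v11)
      (- y * v10)
      (y * v7 - y * v9)
      (y * v11)"

lemma opA_linear: "opA d (v + w) = opA d v + opA d w" "opA d (vscale s v) = vscale s (opA d v)"
  by (cases v; cases w; simp add: algebra_simps)+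

lemma opB_linear: "opB d h (v + w) = opB d h v + opB d h w" "opB d h (vscale s v) = vscale s (opB d h v)"
  by (cases v; cases w; simp add: algebra_simps)+

lemma opC_linear: "opC d h y (v + w) = opC d h y v + opC d h y w" "opC d h y (vscale s v) = vscale s (opC d h y v)"
  by (cases v; cases w; simp add: algebra_simps)+

lemma opD_linear: "opD d h y (v + w) = opD d h y v + opD d h y w" "opD d h y (vscale s v) = vscale s (opD d h y v)"
  by (cases v; cases w; simp add: algebra_simps)+

lemma opY_linear: "opY d h y (v + w) = opY d h y v + opY d h y w" "opY d h y (vscale s v) = vscale s (opY d h y v)"
  by (cases v; cases w; simp add: algebra_simps)+

text \<open>This and the next operator identities hold over any commutative ring, for arbitrary
  \<open>d\<close>, \<open>h\<close> and \<open>y\<close>; the values \<alpha>1 and \<alpha>3 enter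
  only later, through congruences.\<close>

lemma opA_square: "opA d (opA d v) = vscale (d^2) v"
  by (cases v) (simp add: algebra_simps power2_eq_square power3_eq_cube power_numeral_reduce)

lemma opB_square: "opB d h (opB d h v) = vscale (d^2) v"
  by (cases v) (simp add: algebra_simps power2_eq_square power3_eq_cube power_numeral_reduce)

lemma opC_square: "opC d h y (opC d h y v) = vscale (d^2) v"
  by (cases v) (simp add: algebra_simps power2_eq_square power3_eq_cube power_numeral_reduce)

lemma opD_square: "opD d h y (opD d h y v) = vscale (d^2) v"
  by (cases v) (simp add: algebra_simps power2_eq_square power3_eq_cube power_numeral_reduce)

lemma opABC: "opC d h y (opA d v) + opB d h (opC d h y v) + opA d (opB d h v) = vscale h v"
  by (cases v) (simp add: algebra_simps power2_eq_square power3_eq_cube power_numeral_reduce)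

lemma opACD: "opD d h y (opA d v) + opC d h y (opD d h y v) + opA d (opC d h y v) = vscale h v"
  by (cases v) (simp add: algebra_simps power2_eq_square power3_eq_cube power_numeral_reduce)

lemma opABD: "opD d h y (opB d h v) + opB d h (opA d v) + opA d (opD d h y v) = vscale h v"
  by (cases v) (simp add: algebra_simps power2_eq_square power3_eq_cube power_numeral_reduce)

lemma opBCD: "opD d h y (opC d h y v) + opC d h y (opB d h v) + opB d h (opD d h y v) = vscale h v"
  by (cases v) (simp add: algebra_simps power2_eq_square power3_eq_cube power_numeral_reduce)

text \<open>Identifies \<open>opY\<close> as the action of the element \<open>y\<close> of the
  deformed algebra; by \<open>opY_cube\<close> its cube is a scalar, although \<open>opY\<close>
  itself is not.\<close>

lemma opY: "opC d h y (opB d h v) + opB d h (opA d v) + opA d (opC d h y v) = vscale h v + opY d h y v"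
  by (cases v) (simp add: algebra_simps power2_eq_square power3_eq_cube power_numeral_reduce)

lemma opY_cube: "opY d h y (opY d h y (opY d h y v)) = vscale (y^3) v"
  by (cases v) (simp add: algebra_simps power2_eq_square power3_eq_cube power_numeral_reduce)

lemma vscale_zero_left [simp]: "vscale 0 v = 0"
  by (cases v) (simp add: zero_vec12_def)

lemma vscale_diff_left: "vscale (s - t) v = vscale s v - vscale t v"
  by (cases v) (simp add: minus_vec12_def left_diff_distrib)

lemma vscale_sum: "vscale s (\<Sum>i\<in>A. f i) = (\<Sum>i\<in>A. vscale s (f i))"
  by (induction A rule: infinite_finite_induct) (simp_all add: vscale_simps)

lemma vscale_sum_left: "vscale (\<Sum>i\<in>A. f i) v = (\<Sum>i\<in>A. vscale (f i) v)"
  by (induction A rule: infinite_finite_induct) (simp_all add: vscale_simps)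

section \<open>Extending operators of the generators to the free algebra\<close>

locale free_action =
  fixes \<kappa> :: "'k::field \<Rightarrow> 's::comm_ring_1" and act :: "'g \<Rightarrow> 's vec12 \<Rightarrow> 's vec12"
  assumes \<kappa>_add: "\<kappa> (x + y) = \<kappa> x + \<kappa> y"
    and \<kappa>_mult: "\<kappa> (x * y) = \<kappa> x * \<kappa> y"
    and \<kappa>_1 [simp]: "\<kappa> 1 = 1"
    and act_add: "act g (v + w) = act g v + act g w"
    and act_scale: "act g (vscale s v) = vscale s (act g v)"
begin

lemma \<kappa>_0 [simp]: "\<kappa> 0 = 0"
  using \<kappa>_add[of 0 0] by simp

abbreviation act_word :: "'g list \<Rightarrow> 's vec12 \<Rightarrow> 's vec12" where
  "act_word w v \<equiv> foldr act w v"

definition rho :: "('g, 'k) free_algebra \<Rightarrow> 's vec12 \<Rightarrow> 's vec12" where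
  "rho p v = (\<Sum>w\<in>Poly_Mapping.keys p. vscale (\<kappa> (Poly_Mapping.lookup p w)) (act_word (letters w) v))"

lemma act_word_add: "act_word u (v + w) = act_word u v + act_word u w"
  by (induction u) (simp_all add: act_add)

lemma act_word_scale: "act_word u (vscale s v) = vscale s (act_word u v)"
  by (induction u) (simp_all add: act_scale)

lemma act_word_0: "act_word u 0 = 0"
  using act_word_scale[of u 0 0] by simp

lemma act_word_sum: "act_word u (\<Sum>i\<in>A. f i) = (\<Sum>i\<in>A. act_word u (f i))"
  by (induction A rule: infinite_finite_induct) (simp_all add: act_word_add act_word_0)

lemma rho_superset:
  assumes "finite A" "Poly_Mapping.keys p \<subseteq> A"
  shows "rho p v = (\<Sum>w\<in>A. vscale (\<kappa> (Poly_Mapping.lookup p w)) (act_word (letters w) v))"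
  unfolding rho_def using assms by (intro sum.mono_neutral_left) (auto simp: in_keys_iff)

lemma rho_add: "rho (p + q) v = rho p v + rho q v"
proof -
  let ?A = "Poly_Mapping.keys p \<union> Poly_Mapping.keys q"
  have "rho (p + q) v = (\<Sum>w\<in>?A. vscale (\<kappa> (Poly_Mapping.lookup (p + q) w)) (act_word (letters w) v))"
    by (rule rho_superset) (simp_all add: keys_add)
  also have "\<dots> = rho p v + rho q v"
    by (simp add: rho_superset[of ?A p] rho_superset[of ?A q] lookup_add \<kappa>_add vscale_simps sum.distrib)
  finally show ?thesis .
qed

lemma rho_scal: "rho (scal c * p) v = vscale (\<kappa> c) (rho p v)"
proof -
  have "rho (scal c * p) v =
      (\<Sum>w\<in>Poly_Mapping.keys p. vscale (\<kappa> (Poly_Mapping.lookup (scal c * p) w)) (act_word (letters w) v))"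
    by (rule rho_superset) (auto simp: in_keys_iff lookup_scal_mult)
  then show ?thesis
    by (simp add: rho_def vscale_sum vscale_simps lookup_scal_mult \<kappa>_mult)
qed

lemma rho_0 [simp]: "rho 0 v = 0"
  by (simp add: rho_def)

lemma rho_diff: "rho (p - q) v = rho p v - rho q v"
  using rho_add[of "p - q" q v] by (simp add: eq_diff_eq)

lemma rho_sum: "rho (\<Sum>i\<in>A. f i) v = (\<Sum>i\<in>A. rho (f i) v)"
  by (induction A rule: infinite_finite_induct) (simp_all add: rho_add)

lemma rho_word: "rho (word_of w) v = act_word w v"
  by (simp add: rho_def word_of_def vscale_simps)

lemma rho_vadd: "rho p (v + w) = rho p v + rho p w"
  by (simp add: rho_def act_word_add vscale_simps sum.distrib)

lemma rho_vscale: "rho p (vscale s v) = vscale s (rho p v)"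
  by (simp add: rho_def act_word_scale vscale_simps vscale_sum mult.commute)

lemma rho_word_mult: "rho (word_of u * p) v = act_word u (rho p v)"
proof -
  have "word_of u * p = (\<Sum>w\<in>Poly_Mapping.keys p. scal (Poly_Mapping.lookup p w) * word_of (u @ letters w))"
    by (subst (1) fa_expand[of p]) (simp add: sum_distrib_left scal_left_commute word_of_append)
  then show ?thesis
    by (simp add: rho_sum rho_scal rho_word rho_def[of p] act_word_sum act_word_scale)
qed

lemma rho_mult: "rho (p * q) v = rho p (rho q v)"
proof -
  have "p * q = (\<Sum>w\<in>Poly_Mapping.keys p. scal (Poly_Mapping.lookup p w) * (word_of (letters w) * q))"
    by (subst (1) fa_expand[of p]) (simp add: sum_distrib_right mult.assoc)
  then show ?thesis
    by (simp add: rho_sum rho_scal rho_word_mult rho_def[of p])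
qed

lemma rho_gen: "rho (gen_of g) v = act g v"
  by (simp add: gen_of_def rho_word)

lemma rho_1 [simp]: "rho 1 v = v"
  using rho_word[of "[]" v] by simp

lemma rho_scal': "rho (scal c) v = vscale (\<kappa> c) v"
  using rho_scal[of c 1 v] by simp

text \<open>The maps \<open>rho p\<close> are linear over the scalar ring, so they preserve the
  submodule of sums of multiples of \<open>s\<close> and \<open>t\<close>. Working modulo it stands
  in for a module over the quotient ring.\<close>

lemma rel_ideal_congruence:
  assumes p: "p \<in> rel_ideal R"
    and R: "\<And>r v. r \<in> R \<Longrightarrow> rho r v \<in> {vscale s u + vscale t w | u w. True}"
  shows "rho p v \<in> {vscale s u + vscale t w | u w. True}"
proof -
  define J where "J = {p. \<forall>v. rho p v \<in> {vscale s u + vscale t w | u w. True}}"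
  have "two_sided_ideal J"
    unfolding two_sided_ideal_def
  proof (intro conjI ballI allI)
    have "0 = vscale s 0 + vscale t 0" by (simp add: vscale_simps)
    then show "0 \<in> J" unfolding J_def by fastforce
  next
    fix p q assume "p \<in> J" "q \<in> J"
    have "rho (p + q) v \<in> {vscale s u + vscale t w | u w. True}" for v
    proof -
      obtain u w u' w' where "rho p v = vscale s u + vscale t w" "rho q v = vscale s u' + vscale t w'"
        using \<open>p \<in> J\<close> \<open>q \<in> J\<close> unfolding J_def by blast
      then have "rho (p + q) v = vscale s (u + u') + vscale t (w + w')"
        by (simp add: rho_add vscale_simps ac_simps)
      then show ?thesis by blast
    qed
    then show "p + q \<in> J" by (simp add: J_def)
  next
    fix p q assume p: "p \<in> J"
    have "rho (q * p) v \<in> {vscale s u + vscale t w | u w. True}" for v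
    proof -
      obtain u w where "rho p v = vscale s u + vscale t w"
        using p unfolding J_def by blast
      then have "rho (q * p) v = vscale s (rho q u) + vscale t (rho q w)"
        by (simp add: rho_mult rho_vadd rho_vscale)
      then show ?thesis by blast
    qed
    then show "q * p \<in> J" by (simp add: J_def)
    show "p * q \<in> J" using p by (simp add: J_def rho_mult)
  qed
  moreover have "R \<subseteq> J" using R by (auto simp: J_def)
  ultimately show ?thesis
    using rel_ideal_least[of J R] p by (auto simp: J_def)
qed

end

text \<open>Scalars are polynomials in \<open>d\<close> over polynomials in \<open>y\<close>:
  \<open>[:0, 1:]\<close> is the outer variable \<open>d\<close>, \<open>[:[:0, 1:]:]\<close> the
  inner variable \<open>y\<close>, and double brackets embed the field.\<close>

definition T_ops :: "'k::field \<Rightarrow> gen \<Rightarrow> 'k poly poly vec12 \<Rightarrow> 'k poly poly vec12" where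
  "T_ops \<alpha>2 g = (let d = [:0, 1:]; h = [:[:\<alpha>2:]:]; y = [:[:0, 1:]:] in
     case g of Ga \<Rightarrow> opA d | Gb \<Rightarrow> opB d h | Gc \<Rightarrow> opC d h y | Gd \<Rightarrow> opD d h y)"

global_interpretation T: free_action "\<lambda>c. [:[:c:]:]" "T_ops \<alpha>2" for \<alpha>2 :: "'k::field"
  by unfold_locales
    (simp_all add: T_ops_def Let_def opA_linear opB_linear opC_linear opD_linear one_pCons split: gen.split)

text \<open>The square relations act as \<open>d^2 - \<alpha>1\<close>, the cubic one as
  \<open>y^3 - \<alpha>3\<close>, and the mixed quadratic ones as zero.\<close>

lemma rho_T_rels:
  fixes \<alpha>1 \<alpha>2 \<alpha>3 :: "'k::field"
  assumes "r \<in> T_rels \<alpha>1 \<alpha>2 \<alpha>3"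
  shows "T.rho \<alpha>2 r v \<in> {vscale ([:0, 1:]^2 - [:[:\<alpha>1:]:]) u + vscale ([:[:0, 1:]:]^3 - [:[:\<alpha>3:]:]) w | u w. True}"
    (is "_ \<in> ?J")
proof -
  have 0: "0 \<in> ?J"
    by (rule CollectI, rule exI[of _ 0], rule exI[of _ 0]) (simp add: vscale_simps)
  have 1: "vscale ([:0, 1:]^2) v - vscale [:[:\<alpha>1:]:] v \<in> ?J"
    by (rule CollectI, rule exI[of _ v], rule exI[of _ 0]) (simp only: vscale_diff_left vscale_simps add_0_right simp_thms)
  have 2: "vscale ([:[:0, 1:]:]^3) v - vscale [:[:\<alpha>3:]:] v \<in> ?J"
    by (rule CollectI, rule exI[of _ 0], rule exI[of _ v]) (simp only: vscale_diff_left vscale_simps add_0_left simp_thms)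
  note rho = T.rho_add T.rho_diff T.rho_mult T.rho_gen T.rho_scal' T_ops_def Let_def gen.case
    power2_eq_square[where 'a = "(gen, 'k) free_algebra"]
  define p where
    "p = gen_of Gc * gen_of Gb + gen_of Gb * gen_of Ga + gen_of Ga * gen_of Gc - (scal \<alpha>2 :: (gen, 'k) free_algebra)"
  have y: "T.rho \<alpha>2 p u = opY [:0, 1:] [:[:\<alpha>2:]:] [:[:0, 1:]:] u" for u
    unfolding p_def using opY[of "[:0, 1:]" "[:[:\<alpha>2:]:]" "[:[:0, 1:]:]" u] by (simp only: rho) simp
  have 3: "T.rho \<alpha>2 (p^3 - scal \<alpha>3) v \<in> ?J"
    by (simp only: power3_eq_cube[where 'a = "(gen, 'k) free_algebra"] T.rho_diff T.rho_mult y
        opY_cube T.rho_scal' 2)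
  from assms show ?thesis
    unfolding T_rels_def Let_def p_def[symmetric]
    by (elim insertE emptyE; hypsubst)
      (rule 3 | simp only: rho opA_square opB_square opC_square opD_square
        opABC opACD opABD opBCD diff_self 0 1)+
qed

text \<open>The coefficients of \<open>f\<close> are already reduced modulo \<open>Y\<close>, so
  \<open>f\<close> is a multiple of \<open>D\<close>, which has degree 2 in \<open>d\<close>; being
  of smaller degree, \<open>f\<close> vanishes.\<close>

lemma quadratic_cubic_independent:
  fixes \<alpha> \<beta> :: "'k::field" and f :: "'k poly poly"
  assumes f: "f = ([:0, 1:]^2 - [:[:\<alpha>:]:]) * p + ([:[:0, 1:]:]^3 - [:[:\<beta>:]:]) * q"
    and deg: "degree f < 2" "\<And>n. degree (coeff f n) < 3"
  shows "f = 0"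
proof -
  define Y :: "'k poly" where "Y = [:0, 1:]^3 - [:\<beta>:]"
  define D :: "'k poly poly" where "D = [:[:-\<alpha>:], 0, 1:]"
  have Y: "Y = [:-\<beta>, 0, 0, 1:]" by (simp add: Y_def power3_eq_cube)
  have D: "[:0, 1:]^2 - [:[:\<alpha>:]:] = D" by (simp add: D_def power2_eq_square)
  have "[:[:0, 1:]:]^3 - [:[:\<beta>:]:] = [:Y:]" by (simp add: Y_def power3_eq_cube)
  with f D have f': "f = D * p + [:Y:] * q" by simp
  \<comment> \<open>Reduction modulo \<open>Y\<close> kills the term with \<open>q\<close> and
    commutes with multiplication by \<open>D\<close>, whose coefficients are constants.\<close>
  define r where "r = map_poly (\<lambda>g. g mod Y) p"
  have coeff_D: "coeff (D * g) n = smult (-\<alpha>) (coeff g n) + (if n < 2 then 0 else coeff g (n - 2))" for g n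
    by (cases n; cases "n - 1") (auto simp: D_def coeff_pCons)
  have "coeff f n = coeff (D * r) n" for n
  proof -
    have "coeff f n = coeff f n mod Y"
      using deg(2)[of n] by (simp add: mod_poly_less Y)
    also have "\<dots> = coeff (D * r) n"
      by (simp add: f' coeff_D r_def coeff_map_poly poly_mod_add_left poly_mod_diff_left mod_smult_left mod_poly_less)
    finally show ?thesis .
  qed
  then have fr: "f = D * r" by (rule poly_eqI)
  show ?thesis
  proof (rule ccontr)
    assume "f \<noteq> 0"
    with fr have "D \<noteq> 0" "r \<noteq> 0" by auto
    then have "degree f = degree D + degree r" unfolding fr by (rule degree_mult_eq)
    with deg(1) show False by (simp add: D_def)
  qed
qed


text \<open>Representatives in the free algebra; the parameter 0 gives their leading forms, the
  monomials that span \<open>B\<close>.\<close>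

definition T_poly :: "'k::field \<Rightarrow> nat \<times> nat \<times> nat \<times> nat \<times> nat \<Rightarrow> (gen, 'k) free_algebra" where
  "T_poly \<alpha>2 = (\<lambda>(n1, n2, n3, n4, n5).
     let a = gen_of Ga; b = gen_of Gb; c = gen_of Gc; d = gen_of Gd; y = a*c + c*b + b*a - scal \<alpha>2
     in (b - a)^n1 * a^n2 * c^n3 * y^n4 * d^n5)"

lemma T_basis_elem_eq: "T_basis_elem \<alpha>1 \<alpha>2 \<alpha>3 t = pres_class (T_rels \<alpha>1 \<alpha>2 \<alpha>3) (T_poly \<alpha>2 t)"
  by (cases t) (simp add: T_basis_elem_def T_poly_def Let_def)

text \<open>The number \<open>4 * i + 2 * j + k\<close> is the position of
  \<open>(b - a)^i * a^j * c^k\<close> in lexicographic order.\<close>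

definition unit12 :: "nat \<Rightarrow> nat \<Rightarrow> nat \<Rightarrow> 's::comm_ring_1 vec12" where
  "unit12 i j k = (let u = (\<lambda>n. if 4 * i + 2 * j + k = n then 1 else 0)
     in V (u 0) (u 1) (u 2) (u 3) (u 4) (u 5) (u 6) (u 7) (u 8) (u 9) (u 10) (u 11))"

text \<open>On the first basis vector \<open>d\<close> and \<open>y\<close> act as the scalars of
  the same name, which pass through the linear operators; the remaining factors move it to its own
  basis vector.\<close>

lemma rho_T_poly:
  assumes "i \<in> {0,1,2}" "j \<in> {0,1}" "k \<in> {0,1}"
  shows "T.rho \<alpha>2 (T_poly \<alpha>2 (i, j, k, l, m)) (unit12 0 0 0) =
    vscale ([:[:0, 1:]:]^l * [:0, 1:]^m) (unit12 i j k)"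
proof -
  let ?d = "[:0, 1:] :: 'a poly poly" and ?h = "[:[:\<alpha>2:]:]" and ?y = "[:[:0, 1:]:] :: 'a poly poly"
  have d: "T.rho \<alpha>2 (gen_of Gd ^ m) (unit12 0 0 0) = vscale (?d^m) (unit12 0 0 0)" for m
  proof (induction m)
    case (Suc m)
    have "T_ops \<alpha>2 Gd (unit12 0 0 0) = vscale ?d (unit12 0 0 0)"
      by (simp add: T_ops_def unit12_def Let_def)
    then show ?case
      by (simp add: T.rho_mult T.rho_gen Suc T.act_scale vscale_simps mult.commute)
  qed (simp add: vscale_simps)
  define p :: "(gen, 'a) free_algebra"
    where "p = gen_of Ga * gen_of Gc + gen_of Gc * gen_of Gb + gen_of Gb * gen_of Ga - scal \<alpha>2"
  have y1: "T.rho \<alpha>2 p u = opY ?d ?h ?y u" for u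
    unfolding p_def using opY[of ?d ?h ?y u]
    by (simp add: T.rho_add T.rho_diff T.rho_mult T.rho_gen T.rho_scal' T_ops_def ac_simps)
  have y: "T.rho \<alpha>2 (p ^ l) (unit12 0 0 0) = vscale (?y^l) (unit12 0 0 0)" for l
  proof (induction l)
    case (Suc l)
    have "opY ?d ?h ?y (unit12 0 0 0) = vscale ?y (unit12 0 0 0)"
      by (simp add: unit12_def Let_def)
    then show ?case
      by (simp add: T.rho_mult y1 Suc opY_linear vscale_simps mult.commute)
  qed (simp add: vscale_simps)
  have u: "T.rho \<alpha>2 ((gen_of Gb - gen_of Ga)^i * gen_of Ga^j * gen_of Gc^k) (unit12 0 0 0) = unit12 i j k"
    using assms
    by (elim insertE emptyE)
      (simp_all add: T.rho_mult T.rho_gen T.rho_diff T_ops_def unit12_def Let_def minus_vec12_def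
        power2_eq_square)
  have "T_poly \<alpha>2 (i, j, k, l, m) =
      (gen_of Gb - gen_of Ga)^i * gen_of Ga^j * gen_of Gc^k * p^l * gen_of Gd^m"
    by (simp add: T_poly_def p_def Let_def)
  then show ?thesis
    by (simp only: T.rho_mult[of _ "_ * p^l"] T.rho_mult[of _ _ "gen_of Gd^m"] T.rho_mult[of _ "_" "p^l"] d T.rho_vscale y u vscale_simps mult.commute)
qed

text \<open>Applied to the first basis vector, a relation separates by \<open>(i, j, k)\<close> into
  coordinates; \<open>quadratic_cubic_independent\<close> then treats the powers of \<open>y\<close>
  and \<open>d\<close> within each coordinate.\<close>

lemma T_poly_independent:
  assumes "(\<Sum>t\<in>T_basis_index. scal (c t) * T_poly \<alpha>2 t) \<in> rel_ideal (T_rels \<alpha>1 \<alpha>2 \<alpha>3)"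
    and "t \<in> T_basis_index"
  shows "c t = 0"
proof -
  define f where "f = (\<lambda>i j k. \<Sum>l\<in>{0,1,2}. \<Sum>m\<in>{0,1}. [:[:c (i, j, k, l, m):]:] * ([:[:0, 1:]:]^l * [:0, 1:]^m))"
  have "T.rho \<alpha>2 (\<Sum>t\<in>T_basis_index. scal (c t) * T_poly \<alpha>2 t) (unit12 0 0 0) =
     (\<Sum>i\<in>{0,1,2}. \<Sum>j\<in>{0,1}. \<Sum>k\<in>{0,1}. \<Sum>l\<in>{0,1,2}. \<Sum>m\<in>{0,1}.
       vscale [:[:c (i, j, k, l, m):]:] (vscale ([:[:0, 1:]:]^l * [:0, 1:]^m) (unit12 i j k)))"
    unfolding T.rho_sum T.rho_scal T_basis_index_def sum.cartesian_product[symmetric, of "\<lambda>x y. _ (x, y)", simplified]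
    by (auto simp: rho_T_poly sum.cartesian_product intro!: sum.cong)
  also have "\<dots> = (\<Sum>i\<in>{0,1,2}. \<Sum>j\<in>{0,1}. \<Sum>k\<in>{0,1}. vscale (f i j k) (unit12 i j k))"
    by (simp only: f_def vscale_sum_left vscale_simps)
  also have "\<dots> = V (f 0 0 0) (f 0 0 1) (f 0 1 0) (f 0 1 1) (f 1 0 0) (f 1 0 1) (f 1 1 0) (f 1 1 1)
      (f 2 0 0) (f 2 0 1) (f 2 1 0) (f 2 1 1)"
    by (simp add: unit12_def Let_def zero_vec12_def)
  finally have rho: "T.rho \<alpha>2 (\<Sum>t\<in>T_basis_index. scal (c t) * T_poly \<alpha>2 t) (unit12 0 0 0) = \<dots>" .
  let ?s = "[:0, 1:]^2 - [:[:\<alpha>1:]:]" and ?t = "[:[:0, 1:]:]^3 - [:[:\<alpha>3:]:]"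
  obtain u w where uw: "V (f 0 0 0) (f 0 0 1) (f 0 1 0) (f 0 1 1) (f 1 0 0) (f 1 0 1) (f 1 1 0) (f 1 1 1)
      (f 2 0 0) (f 2 0 1) (f 2 1 0) (f 2 1 1) = vscale ?s u + vscale ?t w"
    using T.rel_ideal_congruence[OF assms(1), of \<alpha>2 ?s ?t "unit12 0 0 0", OF rho_T_rels] unfolding rho by blast
  have zero: "f i j k = 0" if "f i j k = ?s * p + ?t * q" for i j k p q
  proof (rule quadratic_cubic_independent[OF that])
    have "f i j k = [:[:c (i,j,k,0,0), c (i,j,k,1,0), c (i,j,k,2,0):], [:c (i,j,k,0,1), c (i,j,k,1,1), c (i,j,k,2,1):]:]"
      by (simp add: f_def power2_eq_square)
    then show "degree (f i j k) < 2" "degree (coeff (f i j k) n) < 3" for n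
      by (auto simp: coeff_pCons less_Suc_eq_le degree_pCons_eq_if split: nat.split)
  qed
  have "f i j k = 0" if "i \<in> {0,1,2}" "j \<in> {0,1}" "k \<in> {0,1}" for i j k
    using uw zero that by (cases u; cases w) auto
  moreover have "f i j k = [:[:c (i,j,k,0,0), c (i,j,k,1,0), c (i,j,k,2,0):], [:c (i,j,k,0,1), c (i,j,k,1,1), c (i,j,k,2,1):]:]" for i j k
    by (simp add: f_def power2_eq_square)
  ultimately show ?thesis
    using assms(2) by (auto simp: T_basis_index_def)
qed

section \<open>Leading forms\<close>

lemma B_rels_spanning: "\<exists>q\<in>fa.span (T_poly 0 ` T_basis_index). p - q \<in> rel_ideal B_rels"
proof -
  define a b c d where "a = (gen_of Ga :: (gen, 'a) free_algebra)" and "b = (gen_of Gb :: (gen, 'a) free_algebra)"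
    and "c = (gen_of Gc :: (gen, 'a) free_algebra)" and "d = (gen_of Gd :: (gen, 'a) free_algebra)"
  define e y where "e = b - a" and "y = a * c + c * b + b * a"
  let ?N = "{e^i * a^j * c^k * y^l * d^m | i j k l m. i < 3 \<and> j < 2 \<and> k < 2 \<and> l < 3 \<and> m < 2}"
  have "p \<in> fa.span (?N \<union> rel_ideal B_rels)"
    unfolding e_def y_def a_def b_def c_def d_def by (rule spanning.S_UNIV) (unfold_locales)
  moreover have "?N \<subseteq> T_poly 0 ` T_basis_index"
  proof clarify
    fix i j k l m :: nat
    assume "i < 3" "j < 2" "k < 2" "l < 3" "m < 2"
    then have "i \<in> {0,1,2}" "j \<in> {0,1}" "k \<in> {0,1}" "l \<in> {0,1,2}" "m \<in> {0,1}" by auto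
    then have "(i, j, k, l, m) \<in> T_basis_index" by (simp only: T_basis_index_def mem_Sigma_iff simp_thms)
    then show "e^i * a^j * c^k * y^l * d^m \<in> T_poly 0 ` T_basis_index"
      by (rule rev_image_eqI) (simp add: T_poly_def Let_def a_def b_def c_def d_def e_def y_def)
  qed
  then have "fa.span (?N \<union> rel_ideal B_rels) \<subseteq> fa.span (T_poly 0 ` T_basis_index \<union> rel_ideal B_rels)"
    by (rule fa.span_mono[OF Un_mono[OF _ subset_refl]])
  ultimately have "p \<in> fa.span (T_poly 0 ` T_basis_index \<union> rel_ideal B_rels)" ..
  \<comment> \<open>The span of a union is the sum of the spans, and the ideal is its own
    span.\<close>
  then obtain q r where "q \<in> fa.span (T_poly 0 ` T_basis_index)" "r \<in> rel_ideal B_rels" "p = q + r"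
    by (auto simp: fa.span_Un fa.span_eq_iff[THEN iffD2, OF rel_ideal_subspace])
  then show ?thesis by (intro bexI[of _ q]) simp_all
qed

definition leads :: "nat \<Rightarrow> ('g, 'k::field) free_algebra \<Rightarrow> ('g, 'k) free_algebra \<Rightarrow> bool" where
  "leads n q p \<longleftrightarrow> q \<in> homog n \<and> p - q \<in> degless n"

lemma leads_refl: "q \<in> homog n \<Longrightarrow> leads n q q"
  using fa.subspace_0[OF degless_subspace] by (simp add: leads_def)

lemma leads_mult:
  assumes "leads m q p" "leads n q' p'"
  shows "leads (m + n) (q * q') (p * p')"
proof -
  have "p' - q' \<in> degless (Suc n)" "q' \<in> degless (Suc n)"
    using assms(2) homog_degless[of n] degless_mono[of n "Suc n"] by (auto simp: leads_def)
  from fa.subspace_add[OF degless_subspace this] have "p' \<in> degless (Suc n)" by simp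
  then have "(p - q) * p' \<in> degless (m + n)"
    using assms(1) by (intro degless_mult) (simp_all add: leads_def)
  moreover have "q * (p' - q') \<in> degless (m + n)"
    using assms homog_degless[of m] by (intro degless_mult') (auto simp: leads_def)
  ultimately have "(p - q) * p' + q * (p' - q') \<in> degless (m + n)"
    by (rule fa.subspace_add[OF degless_subspace])
  also have "(p - q) * p' + q * (p' - q') = p * p' - q * q'"
    by (simp add: algebra_simps)
  finally show ?thesis
    using assms by (simp add: leads_def homog_mult)
qed

lemma leads_power: "leads m q p \<Longrightarrow> leads (k * m) (q ^ k) (p ^ k)"
  by (induction k) (simp_all add: leads_mult leads_refl[OF one_homog])

lemma gen_homog: "gen_of x \<in> homog 1"
  by (simp add: gen_of_def word_of_def homog_def)

lemma homog_closed: "p \<in> homog n \<Longrightarrow> q \<in> homog n \<Longrightarrow> p + q \<in> homog n"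
  "p \<in> homog n \<Longrightarrow> q \<in> homog n \<Longrightarrow> p - q \<in> homog n"
  using homog_subspace by (blast intro: fa.subspace_add fa.subspace_diff)+

lemma gen_mult_homog: "gen_of x * gen_of x' \<in> homog 2"
  using homog_mult[OF gen_homog gen_homog, of x x'] by (simp add: numeral_2_eq_2)

lemma scal_degless: "0 < n \<Longrightarrow> scal c \<in> degless n"
  by (auto simp: scal_def degless_def)

lemma leads_y: "leads 2 (gen_of Ga * gen_of Gc + gen_of Gc * gen_of Gb + gen_of Gb * gen_of Ga)
    (gen_of Ga * gen_of Gc + gen_of Gc * gen_of Gb + gen_of Gb * gen_of Ga - scal k)"
  using fa.subspace_neg[OF degless_subspace scal_degless[of 2 k]]
  by (simp add: leads_def homog_closed gen_mult_homog)

text \<open>The exponent of \<open>y\<close> counts twice because the leading form of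
  \<open>y\<close> is quadratic.\<close>

definition T_degree :: "nat \<times> nat \<times> nat \<times> nat \<times> nat \<Rightarrow> nat" where
  "T_degree = (\<lambda>(n1, n2, n3, n4, n5). n1 + n2 + n3 + n4 * 2 + n5)"

lemma leads_T_poly: "leads (T_degree t) (T_poly 0 t) (T_poly \<alpha>2 t)"
proof -
  obtain i j k l m where t: "t = (i, j, k, l, m)" by (cases t)
  have x: "leads n (gen_of x ^ n) (gen_of x ^ n)" for n x
    using leads_power[OF leads_refl[OF gen_homog], of n x] by simp
  have e: "leads i ((gen_of Gb - gen_of Ga) ^ i) ((gen_of Gb - gen_of Ga) ^ i)"
    using leads_power[OF leads_refl[OF homog_closed(2)[OF gen_homog gen_homog]], of i] by simp
  have "leads (i + j + k + l * 2 + m) (T_poly 0 t) (T_poly \<alpha>2 t)"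
    using leads_mult[OF leads_mult[OF leads_mult[OF leads_mult[OF e x] x] leads_power[OF leads_y]] x]
    by (simp add: T_poly_def t Let_def)
  then show ?thesis by (simp add: T_degree_def t)
qed

text \<open>The cubes of \<open>y\<close> and \<open>z\<close> share the leading form
  \<open>q^3\<close>, so their difference has degree below 6, and the cubic relation turns
  \<open>y^3\<close> into a scalar.\<close>

lemma T_rels_sixth_power:
  fixes \<alpha>1 \<alpha>2 \<alpha>3 :: "'k::field"
  shows "\<exists>s\<in>degless 6. (gen_of Ga + gen_of Gb + gen_of Gc)^6 - s \<in> rel_ideal (T_rels \<alpha>1 \<alpha>2 \<alpha>3)"
proof -
  define a b c where "a = (gen_of Ga :: (gen, 'k) free_algebra)" and "b = (gen_of Gb :: (gen, 'k) free_algebra)"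
    and "c = (gen_of Gc :: (gen, 'k) free_algebra)"
  let ?I = "rel_ideal (T_rels \<alpha>1 \<alpha>2 \<alpha>3)"
  define q where "q = a * c + c * b + b * a"
  define y where "y = q - scal \<alpha>2"
  \<comment> \<open>The scalar is subtracted in this form so that \<open>leads_y\<close> applies to
    \<open>z\<close> as well as to \<open>y\<close>.\<close>
  define z where "z = q - scal (- 3 * \<alpha>1 - \<alpha>2)"
  \<comment> \<open>By the quadratic relations, \<open>(a + b + c)\<^sup>2\<close> agrees with \<open>z\<close>, which differs from \<open>y\<close> by a scalar.\<close>
  define u where "u = (a + b + c) * (a + b + c)"
  define s where "s = scal \<alpha>3 + (z^3 - y^3)"
  have "leads (3 * 2) (q^3) (y^3)" "leads (3 * 2) (q^3) (z^3)"
    unfolding y_def z_def q_def a_def b_def c_def by (intro leads_power leads_y)+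
  then have "z^3 - q^3 \<in> degless 6" "y^3 - q^3 \<in> degless 6" by (simp_all add: leads_def)
  then have "(z^3 - q^3) - (y^3 - q^3) \<in> degless 6"
    by (rule fa.subspace_diff[OF degless_subspace])
  then have "s \<in> degless 6"
    unfolding s_def by (intro fa.subspace_add degless_subspace scal_degless) simp_all
  have rels: "a * a - scal \<alpha>1 \<in> ?I" "b * b - scal \<alpha>1 \<in> ?I" "c * c - scal \<alpha>1 \<in> ?I"
    "c * a + b * c + a * b - scal \<alpha>2 \<in> ?I" "y^3 - scal \<alpha>3 \<in> ?I"
    unfolding a_def b_def c_def y_def q_def
    by (rule rel_ideal_base; simp add: T_rels_def Let_def power2_eq_square add_ac)+
  have "(scal (- 3 * \<alpha>1 - \<alpha>2) :: (gen, 'k) free_algebra) = - (scal \<alpha>1 + scal \<alpha>1 + scal \<alpha>1 + scal \<alpha>2)"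
    by (simp add: scal_def single_add[symmetric] single_uminus[symmetric])
  then have z: "z = q + (scal \<alpha>1 + scal \<alpha>1 + scal \<alpha>1 + scal \<alpha>2)"
    by (simp only: z_def diff_minus_eq_add)
  have "u - z = (a * a - scal \<alpha>1) + (b * b - scal \<alpha>1) + (c * c - scal \<alpha>1) + (c * a + b * c + a * b - scal \<alpha>2)"
    by (simp add: u_def z q_def algebra_simps)
  then have uz: "u - z \<in> ?I"
    using rels by (simp add: rel_ideal_add)
  have "(a + b + c)^6 = u * u * u"
    by (simp add: u_def numeral_eq_Suc mult.assoc)
  \<comment> \<open>The first three terms telescope to the difference of the cubes of
    \<open>u\<close> and \<open>z\<close>.\<close>
  then have "(a + b + c)^6 - s = (u - z) * (u * u) + z * ((u - z) * u) + z * z * (u - z) + (y^3 - scal \<alpha>3)"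
    by (simp add: s_def power3_eq_cube algebra_simps)
  also have "\<dots> \<in> ?I"
    by (intro rel_ideal_add rel_ideal_mult_left rel_ideal_mult_right uz rels)
  finally show ?thesis
    using \<open>s \<in> degless 6\<close> unfolding a_def b_def c_def by blast
qed

text \<open>The eight quadratic relations differ from relations of the deformed algebra by scalars,
  which have degree below 2.\<close>

lemma B_rels_leads:
  fixes \<alpha>1 \<alpha>2 \<alpha>3 :: "'k::field"
  assumes "r \<in> B_rels"
  shows "\<exists>n. r \<in> homog n \<and> (\<exists>s\<in>degless n. r - s \<in> rel_ideal (T_rels \<alpha>1 \<alpha>2 \<alpha>3))"
proof -
  let ?P = "\<lambda>r. \<exists>n. r \<in> homog n \<and> (\<exists>s\<in>degless n. r - s \<in> rel_ideal (T_rels \<alpha>1 \<alpha>2 \<alpha>3))"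
  have quad: "?P r" if "r \<in> homog 2" "r - scal k \<in> T_rels \<alpha>1 \<alpha>2 \<alpha>3" for r k
    using that rel_ideal_base scal_degless[of 2 k] by (intro exI[of _ 2]) auto
  have "(gen_of Ga + gen_of Gb + gen_of Gc :: (gen, 'k) free_algebra) \<in> homog 1"
    by (intro homog_closed gen_homog)
  from leads_power[OF leads_refl[OF this], of 6]
  have "leads 6 ((gen_of Ga + gen_of Gb + gen_of Gc)^6) ((gen_of Ga + gen_of Gb + gen_of Gc :: (gen, 'k) free_algebra)^6)"
    by simp
  then have six: "?P ((gen_of Ga + gen_of Gb + gen_of Gc)^6)"
    using T_rels_sixth_power unfolding leads_def by blast
  have sq: "gen_of x ^ 2 \<in> homog 2" for x :: gen
    using gen_mult_homog[of x x] by (simp add: power2_eq_square)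
  have "r = (gen_of Ga + gen_of Gb + gen_of Gc)^6 \<or>
      r \<in> homog 2 \<and> (r - scal \<alpha>1 \<in> T_rels \<alpha>1 \<alpha>2 \<alpha>3 \<or> r - scal \<alpha>2 \<in> T_rels \<alpha>1 \<alpha>2 \<alpha>3)"
    using assms unfolding B_rels_def Let_def
    by (elim insertE emptyE; hypsubst)
      (simp_all add: sq homog_closed gen_mult_homog T_rels_def Let_def add_ac)
  then show ?thesis using six quad by blast
qed

theorem theorem4p9:
  fixes \<alpha>1 \<alpha>2 \<alpha>3 :: "'k::alg_closed_field"
  assumes "CHAR('k) \<noteq> 2" and "CHAR('k) \<noteq> 3"
  shows "pbw_deformation ring_of_type_algebra
           B_alg (word_grading B_rels)
           (T_alg \<alpha>1 \<alpha>2 \<alpha>3) (word_filtration (T_rels \<alpha>1 \<alpha>2 \<alpha>3))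
       \<and> inj_on (T_basis_elem \<alpha>1 \<alpha>2 \<alpha>3) T_basis_index
       \<and> vectorspace.basis ring_of_type_algebra (T_alg \<alpha>1 \<alpha>2 \<alpha>3)
           (T_basis_elem \<alpha>1 \<alpha>2 \<alpha>3 ` T_basis_index)"
proof -
  \<comment> \<open>The family with parameter \<open>\<alpha>2\<close> serves as \<open>M\<close>,
    and the one with parameter 0 as its leading forms \<open>N\<close>.\<close>
  interpret pbw_data B_rels "T_rels \<alpha>1 \<alpha>2 \<alpha>3" T_basis_index "T_poly \<alpha>2" "T_poly 0" T_degree
  proof
    show "finite T_basis_index" by (simp add: T_basis_index_def)
    show "(T_poly 0 t :: (gen, 'k) free_algebra) \<in> homog (T_degree t)" "T_poly \<alpha>2 t - T_poly 0 t \<in> degless (T_degree t)" for t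
      using leads_T_poly[of t \<alpha>2] by (simp_all add: leads_def)
  qed (use B_rels_leads B_rels_spanning T_poly_independent in blast)+
  have "T_basis_elem \<alpha>1 \<alpha>2 \<alpha>3 = (\<lambda>t. pres_class (T_rels \<alpha>1 \<alpha>2 \<alpha>3) (T_poly \<alpha>2 t))"
    by (rule ext) (rule T_basis_elem_eq)
  then show ?thesis using pbw T_basis by simp
qed

end
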